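(* Let \[B(t,x,y)=\sum_{n\ge 0}\ \sum_{\pi\in \mathfrak{S}_n^{[3]}(231)} t^{c_1(\pi)}x^{c_2(\pi)}y^{c_3(\pi)}.\] Then \[ B(t,x,y) = \dfrac{(1-x)^2(1-2y)}{1 - 3 x - 3 y - t + 2 x^2 + 5 x y + t x - 5 x^2 y - 4 t x y - t^2y}. \]
   Context: $\mathfrak{S}_n$ is the symmetric group on $[n]=\{1,\dots,n\}$; permutations are written in one-line notation $\pi=\pi_1\cdots\pi_n$ with $\pi_i=\pi(i)$. A permutation $\pi$ contains a pattern $\sigma\in\mathfrak{S}_k$ if some subsequence of $\pi_1\cdots\pi_n$ of length $k$ is in the same relative order as $\sigma$; otherwise $\pi$ avoids $\sigma$. $\mathfrak{S}_n^{[3]}(231)$ is the set of permutations in $\mathfrak{S}_n$ that avoid $231$ and all of whose cycles (in the disjoint cycle decomposition) have length $1$, $2$ or $3$; $\mathfrak{S}_0^{[3]}(231)$ consists of the empty permutation. $c_k(\pi)$ denotes the number of $k$-cycles of $\pi$. *)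

theory Defs
  imports "HOL-Computational_Algebra.Formal_Power_Series" "HOL-Combinatorics.Combinatorics"
begin

definition avoids231 :: "nat \<Rightarrow> (nat \<Rightarrow> nat) \<Rightarrow> bool" where
  "avoids231 n \<pi> \<longleftrightarrow>
     \<not> (\<exists>i j k. 1 \<le> i \<and> i < j \<and> j < k \<and> k \<le> n \<and> \<pi> k < \<pi> i \<and> \<pi> i < \<pi> j)"

definition S3_231 :: "nat \<Rightarrow> (nat \<Rightarrow> nat) set" where
  "S3_231 n = {\<pi>. \<pi> permutes {1..n} \<and> avoids231 n \<pi> \<and>
                  (\<forall>i\<in>{1..n}. card (orbit \<pi> i) \<in> {1,2,3})}"

definition ncycles :: "nat \<Rightarrow> nat \<Rightarrow> (nat \<Rightarrow> nat) \<Rightarrow> nat" where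
  "ncycles k n \<pi> = card {i \<in> {1..n}. card (orbit \<pi> i) = k} div k"

text \<open>Coefficient of t^a x^b y^c in B(t,x,y): since c1 + 2 c2 + 3 c3 = n, only
  n = a + 2b + 3c contributes.\<close>

definition Bcoeff :: "nat \<Rightarrow> nat \<Rightarrow> nat \<Rightarrow> nat" where
  "Bcoeff a b c = card {\<pi> \<in> S3_231 (a + 2*b + 3*c).
       ncycles 1 (a + 2*b + 3*c) \<pi> = a \<and> ncycles 2 (a + 2*b + 3*c) \<pi> = b \<and>
       ncycles 3 (a + 2*b + 3*c) \<pi> = c}"

text \<open>Trivariate formal power series over int as nested fps:
  outer variable y, middle x, inner t.\<close>

type_synonym fps3 = "int fps fps fps"

definition varT :: fps3 where "varT = fps_const (fps_const fps_X)"
definition varX :: fps3 where "varX = fps_const fps_X"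
definition varY :: fps3 where "varY = fps_X"

definition Bseries :: fps3 where
  "Bseries = Abs_fps (\<lambda>c. Abs_fps (\<lambda>b. Abs_fps (\<lambda>a. int (Bcoeff a b c))))"

end

theory Submission
  imports Defs "HOL-Library.Product_Plus"
begin

unbundle fps_syntax

text \<open>
  Everything to the left of the maximum of a 231-avoiding permutation splits off as a direct
  summand, so \<open>B = 1 + B I\<close>, where \<open>I\<close> counts the permutations with \<open>\<pi> 1 = n\<close>. Such a permutation is
  either decreasing or contains a 3-cycle \<open>1 \<mapsto> n \<mapsto> k \<mapsto> 1\<close>. Let \<open>E\<close> count all decreasing permutations
  (including the empty one) and \<open>D\<close> those of the second kind, so \<open>I = E - 1 + D\<close>.

  Deleting \<open>1, k, n\<close> leaves a permutation \<open>\<sigma>\<close> of size \<open>r\<close> of the same class, together with a height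
  \<open>p = k - 2\<close> such that the first \<open>p\<close> entries of \<open>\<sigma>\<close> decrease and the entries exceeding \<open>p\<close> decrease;
  conversely any such pair can be extended. The admissible pairs are: \<open>\<sigma>\<close> decreasing and \<open>p \<le> r\<close>
  arbitrary; \<open>\<sigma>\<close> of the kind counted by \<open>D\<close> and \<open>p\<close> one of \<open>\<sigma> r - 1\<close>, \<open>\<sigma> r\<close>; or \<open>\<sigma>\<close> a direct sum of two
  nonempty decreasing permutations, the first of size \<open>p\<close>. Hence \<open>D = y (M + 2 D + (E - 1)\<^sup>2)\<close> where
  \<open>M\<close> counts the pairs of the first kind, with \<open>(1 - x) E = 1 + t\<close> and \<open>(1 - x) M = 2 E - 1\<close>.
\<close>

section \<open>Weighted generating functions\<close>

text \<open>Coefficients of \<open>gf\<close> are cardinalities, and an infinite set has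
  \<open>card\<close> 0; the sum and product rules hold only when the fibres are finite.\<close>

definition finite_fibres :: "('a \<Rightarrow> 'b) \<Rightarrow> 'a set \<Rightarrow> bool" where
  "finite_fibres W S \<longleftrightarrow> (\<forall>v. finite {s \<in> S. W s = v})"

definition gf :: "('a \<Rightarrow> nat \<times> nat \<times> nat) \<Rightarrow> 'a set \<Rightarrow> fps3" where
  "gf W S = Abs_fps (\<lambda>c. Abs_fps (\<lambda>b. Abs_fps (\<lambda>a. int (card {s \<in> S. W s = (a, b, c)}))))"

lemma gf_nth: "gf W S $ c $ b $ a = int (card {s \<in> S. W s = (a, b, c)})"
  by (simp add: gf_def)

lemma fps3_eqI:
  fixes F G :: fps3
  assumes "\<And>a b c. F $ c $ b $ a = G $ c $ b $ a"
  shows "F = G"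
  using assms by (simp add: fps_eq_iff)

lemma finite_fibres_subset: "finite_fibres W S \<Longrightarrow> R \<subseteq> S \<Longrightarrow> finite_fibres W R"
  unfolding finite_fibres_def by (fast elim: rev_finite_subset)

lemma finite_imp_finite_fibres: "finite S \<Longrightarrow> finite_fibres W S"
  by (simp add: finite_fibres_def)

text \<open>The bijection principle: every combinatorial decomposition below enters the algebra
  through this lemma.\<close>

lemma gf_cong:
  assumes "bij_betw f S R" "\<And>s. s \<in> S \<Longrightarrow> V (f s) = W s"
  shows "gf W S = gf V R"
proof (rule fps3_eqI)
  fix a b c
  have "bij_betw f {s \<in> S. W s = (a, b, c)} {r \<in> R. V r = (a, b, c)}"
    using assms unfolding bij_betw_def by (auto simp: inj_on_def)
  then show "gf W S $ c $ b $ a = gf V R $ c $ b $ a"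
    by (simp add: gf_nth bij_betw_same_card)
qed

lemma gf_image: "inj_on f S \<Longrightarrow> gf W (f ` S) = gf (\<lambda>s. W (f s)) S"
  by (rule gf_cong[where f = f, symmetric]) (simp_all add: bij_betw_imageI)

lemma gf_Un:
  assumes "finite_fibres W (S \<union> R)" "S \<inter> R = {}"
  shows "gf W (S \<union> R) = gf W S + gf W R"
proof (rule fps3_eqI)
  fix a b c
  have "{s \<in> S \<union> R. W s = (a, b, c)} = {s \<in> S. W s = (a, b, c)} \<union> {s \<in> R. W s = (a, b, c)}"
    by auto
  moreover have "finite {s \<in> S. W s = (a, b, c)}" "finite {s \<in> R. W s = (a, b, c)}"
    using finite_fibres_subset[OF assms(1)] unfolding finite_fibres_def by auto
  moreover have "{s \<in> S. W s = (a, b, c)} \<inter> {s \<in> R. W s = (a, b, c)} = {}"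
    using assms(2) by auto
  ultimately show "gf W (S \<union> R) $ c $ b $ a = (gf W S + gf W R) $ c $ b $ a"
    by (simp add: gf_nth card_Un_disjoint)
qed

text \<open>The weight \<open>(a, b, c)\<close> splits coordinatewise into two summands; since
  \<open>(i, j, k)\<close> is bounded by it, truncated subtraction recovers the second
  summand.\<close>

lemma fibre_times:
  fixes a b c :: nat
  shows "{u \<in> S \<times> R. (case u of (s, r) \<Rightarrow> W s + V r) = (a, b, c)} =
    (\<Union>(i, j, k) \<in> {0..a} \<times> {0..b} \<times> {0..c}.
        {s \<in> S. W s = (i, j, k)} \<times> {r \<in> R. V r = (a - i, b - j, c - k)})" (is "?L = ?R")
proof
  show "?L \<subseteq> ?R"
  proof
    fix u assume "u \<in> ?L"
    then obtain s r where u: "u = (s, r)" "s \<in> S" "r \<in> R" "W s + V r = (a, b, c)" by auto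
    obtain i j k where w: "W s = (i, j, k)" by (cases "W s") auto
    obtain i' j' k' where v: "V r = (i', j', k')" by (cases "V r") auto
    from u w v have "i + i' = a" "j + j' = b" "k + k' = c" by auto
    then show "u \<in> ?R" using u w v by (intro UN_I[of "(i, j, k)"]) auto
  qed
qed auto

lemma gf_times:
  assumes "finite_fibres W S" "finite_fibres V R"
  shows "gf (\<lambda>(s, r). W s + V r) (S \<times> R) = gf W S * gf V R"
proof (rule fps3_eqI)
  fix a b c
  let ?F = "\<lambda>(i, j, k). {s \<in> S. W s = (i, j, k)} \<times> {r \<in> R. V r = (a - i, b - j, c - k)}"
  let ?I = "{0..a} \<times> {0..b} \<times> {0..c}"
  have fin: "finite {s \<in> S. W s = v}" "finite {r \<in> R. V r = v}" for v
    using assms unfolding finite_fibres_def by blast+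
  have "card (\<Union>z\<in>?I. ?F z) = (\<Sum>z\<in>?I. card (?F z))"
    by (rule card_UN_disjoint) (use fin in auto)
  also have "\<dots> = (\<Sum>i\<in>{0..a}. \<Sum>j\<in>{0..b}. \<Sum>k\<in>{0..c}.
      card {s \<in> S. W s = (i, j, k)} * card {r \<in> R. V r = (a - i, b - j, c - k)})"
    by (simp add: sum.cartesian_product case_prod_beta card_cartesian_product)
  \<comment> \<open>Coefficients of a product of nested series come out in the order y, x, t; three
    exchanges of sums reverse the order t, x, y.\<close>
  also have "\<dots> = (\<Sum>i\<in>{0..a}. \<Sum>k\<in>{0..c}. \<Sum>j\<in>{0..b}.
      card {s \<in> S. W s = (i, j, k)} * card {r \<in> R. V r = (a - i, b - j, c - k)})"
    by (intro sum.cong refl sum.swap)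
  also have "\<dots> = (\<Sum>k\<in>{0..c}. \<Sum>i\<in>{0..a}. \<Sum>j\<in>{0..b}.
      card {s \<in> S. W s = (i, j, k)} * card {r \<in> R. V r = (a - i, b - j, c - k)})"
    by (rule sum.swap)
  also have "\<dots> = (\<Sum>k\<in>{0..c}. \<Sum>j\<in>{0..b}. \<Sum>i\<in>{0..a}.
      card {s \<in> S. W s = (i, j, k)} * card {r \<in> R. V r = (a - i, b - j, c - k)})"
    by (intro sum.cong refl sum.swap)
  finally show "gf (\<lambda>(s, r). W s + V r) (S \<times> R) $ c $ b $ a = (gf W S * gf V R) $ c $ b $ a"
    unfolding gf_nth fibre_times by (simp add: fps_mult_nth fps_sum_nth gf_nth)
qed

lemma gf_singleton_nth: "gf W {s} $ c $ b $ a = (if W s = (a, b, c) then 1 else 0)"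
proof -
  have "{r \<in> {s}. W r = (a, b, c)} = (if W s = (a, b, c) then {s} else {})" by auto
  then show ?thesis by (simp add: gf_nth)
qed

lemma gf_singleton:
  shows "W s = (0, 0, 0) \<Longrightarrow> gf W {s} = 1"
    and "W s = (1, 0, 0) \<Longrightarrow> gf W {s} = varT"
    and "W s = (0, 1, 0) \<Longrightarrow> gf W {s} = varX"
    and "W s = (0, 0, 1) \<Longrightarrow> gf W {s} = varY"
  by (auto intro!: fps3_eqI simp: gf_singleton_nth varT_def varX_def varY_def fps_X_def)

text \<open>A constant extra weight is a product with a one-point class, so the product rule
  applies.\<close>

lemma gf_shift:
  assumes "finite_fibres W S"
  shows "gf (\<lambda>s. W s + v) S = gf W S * gf (\<lambda>_. v) {()}"
proof -
  have "gf (\<lambda>s. W s + v) S = gf (\<lambda>(s, r). W s + v) (S \<times> {()})"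
    by (rule gf_cong[where f = "\<lambda>s. (s, ())"]) (auto simp: bij_betw_def inj_on_def)
  also have "\<dots> = gf W S * gf (\<lambda>_. v) {()}"
    using gf_times[OF assms finite_imp_finite_fibres, of "{()}" "\<lambda>_. v"] by simp
  finally show ?thesis .
qed

lemma gf_shift_varX: "finite_fibres W S \<Longrightarrow> gf (\<lambda>s. W s + (0, 1, 0)) S = gf W S * varX"
  using gf_shift[of W S "(0, 1, 0)"] gf_singleton(3)[of "\<lambda>_. (0, 1, 0)" "()"] by simp

lemma gf_shift_varY: "finite_fibres W S \<Longrightarrow> gf (\<lambda>s. W s + (0, 0, 1)) S = gf W S * varY"
  using gf_shift[of W S "(0, 0, 1)"] gf_singleton(4)[of "\<lambda>_. (0, 0, 1)" "()"] by simp

section \<open>Gluing permutations along two blocks\<close>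

text \<open>Free of orbits, so that it passes to conjugates by rewriting; for a permutation it
  bounds the lengths of the cycles meeting \<open>A\<close> by 3.\<close>

definition short_cycles :: "nat set \<Rightarrow> (nat \<Rightarrow> nat) \<Rightarrow> bool" where
  "short_cycles A \<pi> \<longleftrightarrow> (\<forall>i\<in>A. \<pi> i = i \<or> \<pi> (\<pi> i) = i \<or> \<pi> (\<pi> (\<pi> i)) = i)"

definition avoids231_on :: "nat set \<Rightarrow> (nat \<Rightarrow> nat) \<Rightarrow> bool" where
  "avoids231_on A \<pi> \<longleftrightarrow>
    (\<forall>i\<in>A. \<forall>j\<in>A. \<forall>k\<in>A. i < j \<and> j < k \<and> \<pi> i < \<pi> j \<longrightarrow> \<pi> i \<le> \<pi> k)"

text \<open>Cycles are counted at their least element.\<close>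

definition cycle_wt :: "nat set \<Rightarrow> (nat \<Rightarrow> nat) \<Rightarrow> nat \<times> nat \<times> nat" where
  "cycle_wt A \<pi> = (card {i \<in> A. \<pi> i = i}, card {i \<in> A. i < \<pi> i \<and> \<pi> (\<pi> i) = i},
     card {i \<in> A. i < \<pi> i \<and> i < \<pi> (\<pi> i) \<and> \<pi> (\<pi> (\<pi> i)) = i})"

lemma avoids231_onD:
  "avoids231_on A \<pi> \<Longrightarrow> i < j \<Longrightarrow> j < k \<Longrightarrow> \<pi> k < \<pi> i \<Longrightarrow> \<pi> i < \<pi> j \<Longrightarrow>
    i \<in> A \<Longrightarrow> j \<in> A \<Longrightarrow> k \<in> A \<Longrightarrow> False"
  unfolding avoids231_on_def using not_le by blast

lemma cycle_wt_Un:
  assumes "finite A" "finite B" "A \<inter> B = {}"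
  shows "cycle_wt (A \<union> B) \<pi> = cycle_wt A \<pi> + cycle_wt B \<pi>"
proof -
  have "card {i \<in> A \<union> B. P i} = card {i \<in> A. P i} + card {i \<in> B. P i}" for P
  proof -
    have "{i \<in> A \<union> B. P i} = {i \<in> A. P i} \<union> {i \<in> B. P i}" by auto
    then show ?thesis using assms by (simp add: card_Un_disjoint disjoint_iff)
  qed
  then show ?thesis by (simp add: cycle_wt_def)
qed

text \<open>Here \<open>g\<close> is an increasing relabelling that carries \<open>\<sigma>\<close>
  on \<open>A\<close> to \<open>\<pi>\<close> on the image. Cycle structure, pattern avoidance and
  least elements of cycles depend only on relative order, so they are preserved.\<close>

context
  fixes A :: "nat set" and g \<sigma> \<pi> :: "nat \<Rightarrow> nat"
  assumes mono: "strict_mono_on A g"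
    and into: "\<And>i. i \<in> A \<Longrightarrow> \<sigma> i \<in> A"
    and conj: "\<And>i. i \<in> A \<Longrightarrow> \<pi> (g i) = g (\<sigma> i)"
begin

private lemma less_iff: "i \<in> A \<Longrightarrow> j \<in> A \<Longrightarrow> g i < g j \<longleftrightarrow> i < j"
  using mono strict_mono_on_less by blast

private lemma le_iff: "i \<in> A \<Longrightarrow> j \<in> A \<Longrightarrow> g i \<le> g j \<longleftrightarrow> i \<le> j"
  using mono strict_mono_on_less_eq by blast

private lemma eq_iff: "i \<in> A \<Longrightarrow> j \<in> A \<Longrightarrow> g i = g j \<longleftrightarrow> i = j"
  using mono strict_mono_on_eq by blast

lemma short_cycles_relabel: "short_cycles (g ` A) \<pi> \<longleftrightarrow> short_cycles A \<sigma>"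
  unfolding short_cycles_def by (simp add: conj into eq_iff)

lemma avoids231_on_relabel: "avoids231_on (g ` A) \<pi> \<longleftrightarrow> avoids231_on A \<sigma>"
  unfolding avoids231_on_def by (simp add: conj into less_iff le_iff)

lemma cycle_wt_relabel: "cycle_wt (g ` A) \<pi> = cycle_wt A \<sigma>"
proof -
  have card: "card {u \<in> g ` A. P u} = card {i \<in> A. Q i}"
    if "\<And>i. i \<in> A \<Longrightarrow> P (g i) \<longleftrightarrow> Q i" for P Q
  proof -
    have "{u \<in> g ` A. P u} = g ` {i \<in> A. Q i}" using that by auto
    moreover have "inj_on g {i \<in> A. Q i}" using eq_iff by (auto intro: inj_onI)
    ultimately show ?thesis by (simp add: card_image)
  qed
  show ?thesis
    unfolding cycle_wt_def
    by (intro arg_cong2[where f = Pair] card) (simp_all add: conj into eq_iff less_iff)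
qed

end

text \<open>Pulling \<open>\<pi>\<close> back along \<open>f\<close> gives an injective self-map of
  a finite set, hence a bijection; extending it by the identity yields a permutation of
  \<open>{1..m}\<close>.\<close>

lemma obtain_restriction:
  assumes "inj_on \<pi> (f ` {1..m})" "\<pi> ` f ` {1..m} \<subseteq> f ` {1..m}" "inj_on f {1..m::nat}"
  obtains \<rho> :: "nat \<Rightarrow> nat" where "\<rho> permutes {1..m}" "\<And>i. i \<in> {1..m} \<Longrightarrow> \<pi> (f i) = f (\<rho> i)"
proof -
  define \<rho> where "\<rho> i = (if i \<in> {1..m} then inv_into {1..m} f (\<pi> (f i)) else i)" for i
  have im: "\<pi> (f i) \<in> f ` {1..m}" if "i \<in> {1..m}" for i
    using assms(2) that by blast
  have \<rho>: "\<rho> i = inv_into {1..m} f (\<pi> (f i))" if "i \<in> {1..m}" for i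
    using that by (simp only: \<rho>_def if_True)
  have eq: "\<pi> (f i) = f (\<rho> i)" if "i \<in> {1..m}" for i
    unfolding \<rho>[OF that] by (rule f_inv_into_f[OF im[OF that], symmetric])
  have into: "\<rho> ` {1..m} \<subseteq> {1..m}"
  proof (rule image_subsetI)
    fix i assume i: "i \<in> {1..m}"
    show "\<rho> i \<in> {1..m}" unfolding \<rho>[OF i] by (rule inv_into_into[OF im[OF i]])
  qed
  have inj: "inj_on \<rho> {1..m}"
  proof (rule inj_onI)
    fix i j assume ij: "i \<in> {1..m}" "j \<in> {1..m}" "\<rho> i = \<rho> j"
    then have "\<pi> (f i) = \<pi> (f j)" using eq[of i] eq[of j] by simp
    then have "f i = f j" by (rule inj_onD[OF assms(1)]) (use ij in blast)+
    then show "i = j" using inj_onD[OF assms(3)] ij(1,2) by blast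
  qed
  have "bij_betw \<rho> {1..m} {1..m}"
    unfolding bij_betw_def using inj endo_inj_surj[OF _ into inj] by blast
  then have "\<rho> permutes {1..m}"
    by (rule bij_imp_permutes) (simp only: \<rho>_def if_False)
  then show thesis using eq that by blast
qed

text \<open>The blocks may interleave. This covers both constructions used later: two consecutive
  intervals for direct sums, and three scattered points against the rest for inserting a
  3-cycle.\<close>

locale two_blocks =
  fixes n r s :: nat and g h :: "nat \<Rightarrow> nat"
  assumes mono_g: "strict_mono_on {1..r} g"
    and mono_h: "strict_mono_on {1..s} h"
    and blocks_Un: "g ` {1..r} \<union> h ` {1..s} = {1..n}"
    and blocks_disjoint: "g ` {1..r} \<inter> h ` {1..s} = {}"
begin

lemma inj_g: "inj_on g {1..r}"
  using mono_g by (rule strict_mono_on_imp_inj_on)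

lemma inj_h: "inj_on h {1..s}"
  using mono_h by (rule strict_mono_on_imp_inj_on)

definition glue :: "(nat \<Rightarrow> nat) \<Rightarrow> (nat \<Rightarrow> nat) \<Rightarrow> nat \<Rightarrow> nat" where
  "glue \<sigma> \<tau> u =
    (if u \<in> g ` {1..r} then g (\<sigma> (inv_into {1..r} g u))
     else if u \<in> h ` {1..s} then h (\<tau> (inv_into {1..s} h u)) else u)"

lemma glue_g: "i \<in> {1..r} \<Longrightarrow> glue \<sigma> \<tau> (g i) = g (\<sigma> i)"
  using inj_g by (simp add: glue_def)

lemma glue_h:
  assumes "i \<in> {1..s}" shows "glue \<sigma> \<tau> (h i) = h (\<tau> i)"
proof -
  have "h i \<notin> g ` {1..r}" using assms blocks_disjoint by blast
  then show ?thesis using inj_h assms by (simp add: glue_def)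
qed

lemma glue_outside: "u \<notin> {1..n} \<Longrightarrow> glue \<sigma> \<tau> u = u"
  using blocks_Un by (auto simp: glue_def)

lemma glue_eqI:
  assumes "\<And>i. i \<in> {1..r} \<Longrightarrow> \<pi> (g i) = g (\<sigma> i)" "\<And>i. i \<in> {1..s} \<Longrightarrow> \<pi> (h i) = h (\<tau> i)"
    and "\<And>u. u \<notin> {1..n} \<Longrightarrow> \<pi> u = u"
  shows "\<pi> = glue \<sigma> \<tau>"
proof
  fix u
  consider "u \<notin> {1..n}" | i where "i \<in> {1..r}" "u = g i" | i where "i \<in> {1..s}" "u = h i"
    using blocks_Un by blast
  then show "\<pi> u = glue \<sigma> \<tau> u"
    by cases (use assms glue_g glue_h glue_outside in metis)+
qed

lemma glue_permutes:
  assumes "\<sigma> permutes {1..r}" "\<tau> permutes {1..s}"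
  shows "glue \<sigma> \<tau> permutes {1..n}"
proof (rule bij_imp_permutes)
  have "glue \<sigma> \<tau> ` (g ` {1..r}) = g ` \<sigma> ` {1..r}"
    unfolding image_image by (rule image_cong) (simp_all only: glue_g)
  then have 1: "glue \<sigma> \<tau> ` (g ` {1..r}) = g ` {1..r}"
    using permutes_image[OF assms(1)] by simp
  have "glue \<sigma> \<tau> ` (h ` {1..s}) = h ` \<tau> ` {1..s}"
    unfolding image_image by (rule image_cong) (simp_all only: glue_h)
  then have 2: "glue \<sigma> \<tau> ` (h ` {1..s}) = h ` {1..s}"
    using permutes_image[OF assms(2)] by simp
  have "glue \<sigma> \<tau> ` {1..n} = {1..n}"
    using 1 2 by (simp only: blocks_Un[symmetric] image_Un)
  then show "bij_betw (glue \<sigma> \<tau>) {1..n} {1..n}"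
    by (simp add: bij_betw_def eq_card_imp_inj_on)
qed (rule glue_outside)

lemma glue_inject:
  assumes "\<sigma> permutes {1..r}" "\<tau> permutes {1..s}" "\<sigma>' permutes {1..r}" "\<tau>' permutes {1..s}"
    and "glue \<sigma> \<tau> = glue \<sigma>' \<tau>'"
  shows "\<sigma> = \<sigma>' \<and> \<tau> = \<tau>'"
proof
  have "\<sigma> i = \<sigma>' i" if "i \<in> {1..r}" for i
  proof (rule inj_onD[OF inj_g])
    show "g (\<sigma> i) = g (\<sigma>' i)" using assms(5) glue_g[OF that] by metis
  qed (use that assms in \<open>simp_all only: permutes_in_image\<close>)
  then show "\<sigma> = \<sigma>'" by (intro ext) (metis assms(1,3) permutes_not_in)
  have "\<tau> i = \<tau>' i" if "i \<in> {1..s}" for i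
  proof (rule inj_onD[OF inj_h])
    show "h (\<tau> i) = h (\<tau>' i)" using assms(5) glue_h[OF that] by metis
  qed (use that assms in \<open>simp_all only: permutes_in_image\<close>)
  then show "\<tau> = \<tau>'" by (intro ext) (metis assms(2,4) permutes_not_in)
qed

text \<open>Invariance of one block is enough: \<open>\<pi>\<close> is bijective, so it also
  preserves the complement, which is the other block.\<close>

lemma glue_cases:
  assumes "\<pi> permutes {1..n}" "\<pi> ` g ` {1..r} \<subseteq> g ` {1..r}"
  obtains \<sigma> \<tau> where "\<sigma> permutes {1..r}" "\<tau> permutes {1..s}" "\<pi> = glue \<sigma> \<tau>"
proof -
  have inj: "inj_on \<pi> X" for X using permutes_inj_on[OF assms(1)] .
  have "\<pi> ` g ` {1..r} = g ` {1..r}"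
    using assms(2) inj by (intro endo_inj_surj) auto
  moreover have "h ` {1..s} = {1..n} - g ` {1..r}"
    using blocks_Un blocks_disjoint by blast
  moreover have "\<pi> ` ({1..n} - g ` {1..r}) = {1..n} - \<pi> ` g ` {1..r}"
    using permutes_image[OF assms(1)] permutes_inj[OF assms(1)] by (simp add: image_set_diff)
  ultimately have "\<pi> ` h ` {1..s} \<subseteq> h ` {1..s}" by simp
  then obtain \<tau> where "\<tau> permutes {1..s}" "\<And>i. i \<in> {1..s} \<Longrightarrow> \<pi> (h i) = h (\<tau> i)"
    using obtain_restriction[OF inj _ inj_h] by blast
  moreover obtain \<sigma> where "\<sigma> permutes {1..r}" "\<And>i. i \<in> {1..r} \<Longrightarrow> \<pi> (g i) = g (\<sigma> i)"
    using obtain_restriction[OF inj assms(2) inj_g] by blast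
  ultimately show thesis
    using that glue_eqI[of \<pi> \<sigma> \<tau>] permutes_not_in[OF assms(1)] by blast
qed

context
  fixes \<sigma> \<tau> :: "nat \<Rightarrow> nat"
  assumes permutes: "\<sigma> permutes {1..r}" "\<tau> permutes {1..s}"
begin

private lemma into: "i \<in> {1..r} \<Longrightarrow> \<sigma> i \<in> {1..r}" "i \<in> {1..s} \<Longrightarrow> \<tau> i \<in> {1..s}"
  using permutes by (simp_all only: permutes_in_image)

text \<open>No cycle leaves its block, so the counts add up block by block.\<close>

lemma cycle_wt_glue: "cycle_wt {1..n} (glue \<sigma> \<tau>) = cycle_wt {1..r} \<sigma> + cycle_wt {1..s} \<tau>"
  unfolding blocks_Un[symmetric]
  by (subst cycle_wt_Un)
    (simp_all only: finite_imageI finite_atLeastAtMost blocks_disjoint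
      cycle_wt_relabel[of "{1..r}" g "\<sigma>" "glue \<sigma> \<tau>", OF mono_g into(1) glue_g] cycle_wt_relabel[of "{1..s}" h "\<tau>" "glue \<sigma> \<tau>", OF mono_h into(2) glue_h])

lemma short_cycles_glue:
  "short_cycles {1..n} (glue \<sigma> \<tau>) \<longleftrightarrow> short_cycles {1..r} \<sigma> \<and> short_cycles {1..s} \<tau>"
proof -
  have "short_cycles {1..n} (glue \<sigma> \<tau>) \<longleftrightarrow>
      short_cycles (g ` {1..r}) (glue \<sigma> \<tau>) \<and> short_cycles (h ` {1..s}) (glue \<sigma> \<tau>)"
    unfolding blocks_Un[symmetric] by (auto simp only: short_cycles_def)
  then show ?thesis
    by (simp only: short_cycles_relabel[of "{1..r}" g "\<sigma>" "glue \<sigma> \<tau>", OF mono_g into(1) glue_g]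
        short_cycles_relabel[of "{1..s}" h "\<tau>" "glue \<sigma> \<tau>", OF mono_h into(2) glue_h])
qed

text \<open>In contrast to cycles, a pattern can use both blocks, so only the single blocks are
  treated here; mixed patterns are excluded separately in each construction.\<close>

lemma avoids231_on_block_g: "avoids231_on (g ` {1..r}) (glue \<sigma> \<tau>) \<longleftrightarrow> avoids231_on {1..r} \<sigma>"
  by (rule avoids231_on_relabel[of "{1..r}" g "\<sigma>" "glue \<sigma> \<tau>", OF mono_g into(1) glue_g])

lemma avoids231_on_block_h: "avoids231_on (h ` {1..s}) (glue \<sigma> \<tau>) \<longleftrightarrow> avoids231_on {1..s} \<tau>"
  by (rule avoids231_on_relabel[of "{1..s}" h "\<tau>" "glue \<sigma> \<tau>", OF mono_h into(2) glue_h])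

end

end

section \<open>Cycle counts\<close>

text \<open>The size of a finite orbit is the least positive return time, which the library calls
  \<open>funpow_dist1 f x x\<close>.\<close>

lemma card_orbit_eq_iff:
  assumes "x \<in> orbit f x"
  shows "card (orbit f x) = d \<longleftrightarrow> 0 < d \<and> (f ^^ d) x = x \<and> (\<forall>m. 0 < m \<and> m < d \<longrightarrow> (f ^^ m) x \<noteq> x)"
proof -
  define d' where "d' = funpow_dist1 f x x"
  have "card (orbit f x) = card ((\<lambda>n. (f ^^ n) x) ` {0..<d'})"
    unfolding d'_def by (rule arg_cong[OF orbit_conv_funpow_dist1[OF assms]])
  also have "\<dots> = d'"
    using card_image[OF inj_on_funpow_dist1[OF assms]] unfolding d'_def by (simp only: card_atLeastLessThan diff_zero)
  finally have card: "card (orbit f x) = d'" .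
  have period: "(f ^^ d') x = x" "0 < d'"
    unfolding d'_def using funpow_dist1_prop[OF assms] by auto
  have least: "(f ^^ m) x \<noteq> x" if "0 < m" "m < d'" for m
    using funpow_dist1_least that unfolding d'_def by metis
  show ?thesis
    unfolding card using period least by (metis linorder_neqE_nat)
qed

text \<open>In the third equivalence \<open>\<pi> i \<noteq> i\<close> already implies
  \<open>\<pi> (\<pi> i) \<noteq> i\<close>, because returns after two and after three steps
  together would fix \<open>i\<close>.\<close>

lemma card_orbit_eq_123:
  fixes \<pi> :: "nat \<Rightarrow> nat"
  assumes "\<pi> permutes {1..n}"
  shows "card (orbit \<pi> i) = 1 \<longleftrightarrow> \<pi> i = i"
    and "card (orbit \<pi> i) = 2 \<longleftrightarrow> \<pi> i \<noteq> i \<and> \<pi> (\<pi> i) = i"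
    and "card (orbit \<pi> i) = 3 \<longleftrightarrow> \<pi> i \<noteq> i \<and> \<pi> (\<pi> (\<pi> i)) = i"
proof -
  have "permutation \<pi>" unfolding permutation_permutes using assms by blast
  then have self: "i \<in> orbit \<pi> i" by (rule permutation_self_in_orbit)
  have "(\<forall>m. 0 < m \<and> m < Suc (Suc 0) \<longrightarrow> P m) \<longleftrightarrow> P (Suc 0)"
    and "(\<forall>m. 0 < m \<and> m < Suc (Suc (Suc 0)) \<longrightarrow> P m) \<longleftrightarrow> P (Suc 0) \<and> P (Suc (Suc 0))" for P
    by (auto simp: less_Suc_eq)
  note aux = this
  show "card (orbit \<pi> i) = 1 \<longleftrightarrow> \<pi> i = i"
    unfolding card_orbit_eq_iff[OF self] by auto
  show "card (orbit \<pi> i) = 2 \<longleftrightarrow> \<pi> i \<noteq> i \<and> \<pi> (\<pi> i) = i"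
    unfolding card_orbit_eq_iff[OF self] numeral_2_eq_2 aux by auto
  show "card (orbit \<pi> i) = 3 \<longleftrightarrow> \<pi> i \<noteq> i \<and> \<pi> (\<pi> (\<pi> i)) = i"
    unfolding card_orbit_eq_iff[OF self] numeral_3_eq_3 aux by auto
qed

text \<open>\<open>ncycles\<close> counts points and divides, \<open>cycle_wt\<close> counts least
  elements. The points on 2-cycles are the least elements \<open>R\<close> together with their
  images.\<close>

lemma card_2cycle_points:
  fixes \<pi> :: "nat \<Rightarrow> nat"
  assumes "\<pi> permutes {1..n}"
  shows "card {i \<in> {1..n}. \<pi> i \<noteq> i \<and> \<pi> (\<pi> i) = i} = 2 * card {i \<in> {1..n}. i < \<pi> i \<and> \<pi> (\<pi> i) = i}"
proof -
  define R where "R = {i \<in> {1..n}. i < \<pi> i \<and> \<pi> (\<pi> i) = i}"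
  have mem: "\<pi> i \<in> {1..n} \<longleftrightarrow> i \<in> {1..n}" for i
    using assms by (rule permutes_in_image)
  have eq: "\<pi> i = \<pi> j \<longleftrightarrow> i = j" for i j
    using permutes_inj[OF assms] by (simp add: inj_eq)
  have swap: "i \<in> R \<or> \<pi> i \<in> R" if "i \<in> {1..n}" "\<pi> i \<noteq> i" "\<pi> (\<pi> i) = i" for i
    using that mem unfolding R_def by (simp del: atLeastAtMost_iff) linarith
  have "{i \<in> {1..n}. \<pi> i \<noteq> i \<and> \<pi> (\<pi> i) = i} = R \<union> \<pi> ` R" (is "?L = ?R")
  proof
    show "?L \<subseteq> ?R"
    proof
      fix i assume "i \<in> ?L"
      then have i: "i \<in> {1..n}" "\<pi> i \<noteq> i" "\<pi> (\<pi> i) = i" by auto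
      from swap[OF i] show "i \<in> ?R"
        using imageI[of "\<pi> i" R \<pi>] by (auto simp only: i(3))
    qed
    show "?R \<subseteq> ?L"
      using mem by (auto simp: R_def eq simp del: atLeastAtMost_iff)
  qed
  moreover have "R \<inter> \<pi> ` R = {}" "finite R" by (auto simp: R_def)
  moreover have "card (\<pi> ` R) = card R"
    using permutes_inj_on[OF assms] by (rule card_image)
  ultimately show ?thesis unfolding R_def[symmetric] by (simp add: card_Un_disjoint)
qed

text \<open>As for 2-cycles, now with three disjoint copies of the set \<open>R\<close> of least
  elements.\<close>

lemma card_3cycle_points:
  fixes \<pi> :: "nat \<Rightarrow> nat"
  assumes "\<pi> permutes {1..n}"
  shows "card {i \<in> {1..n}. \<pi> i \<noteq> i \<and> \<pi> (\<pi> (\<pi> i)) = i} =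
    3 * card {i \<in> {1..n}. i < \<pi> i \<and> i < \<pi> (\<pi> i) \<and> \<pi> (\<pi> (\<pi> i)) = i}"
proof -
  define R where "R = {i \<in> {1..n}. i < \<pi> i \<and> i < \<pi> (\<pi> i) \<and> \<pi> (\<pi> (\<pi> i)) = i}"
  have mem: "\<pi> i \<in> {1..n} \<longleftrightarrow> i \<in> {1..n}" for i
    using assms by (rule permutes_in_image)
  have eq: "\<pi> i = \<pi> j \<longleftrightarrow> i = j" for i j
    using permutes_inj[OF assms] by (simp add: inj_eq)
  have rot: "i \<in> R \<or> \<pi> i \<in> R \<or> \<pi> (\<pi> i) \<in> R"
    if "i \<in> {1..n}" "\<pi> i \<noteq> i" "\<pi> (\<pi> (\<pi> i)) = i" for i
  proof -
    \<comment> \<open>The three points of the cycle are distinct, so one of them is strictly below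
      the other two and lies in \<open>R\<close>.\<close>
    have "\<pi> (\<pi> i) \<noteq> i" "\<pi> (\<pi> i) \<noteq> \<pi> i" using that eq by metis+
    then show ?thesis
      using that mem unfolding R_def by (simp del: atLeastAtMost_iff) linarith
  qed
  have "{i \<in> {1..n}. \<pi> i \<noteq> i \<and> \<pi> (\<pi> (\<pi> i)) = i} = R \<union> (\<pi> ` R \<union> \<pi> ` \<pi> ` R)" (is "?L = ?R")
  proof
    show "?L \<subseteq> ?R"
    proof
      fix i assume "i \<in> ?L"
      then have i: "i \<in> {1..n}" "\<pi> i \<noteq> i" "\<pi> (\<pi> (\<pi> i)) = i" by auto
      from rot[OF i] show "i \<in> ?R"
        using imageI[of "\<pi> (\<pi> i)" R \<pi>] imageI[of "\<pi> (\<pi> i)" "\<pi> ` R" \<pi>] imageI[of "\<pi> i" R \<pi>]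
        by (auto simp only: i(3))
    qed
    show "?R \<subseteq> ?L"
      using mem by (auto simp: R_def eq simp del: atLeastAtMost_iff)
  qed
  moreover have "R \<inter> (\<pi> ` R \<union> \<pi> ` \<pi> ` R) = {}" "\<pi> ` R \<inter> \<pi> ` \<pi> ` R = {}" "finite R"
    by (auto simp: R_def eq)
  moreover have "card (\<pi> ` X) = card X" for X
    using permutes_inj_on[OF assms] by (rule card_image)
  ultimately show ?thesis unfolding R_def[symmetric] by (simp add: card_Un_disjoint)
qed

text \<open>The size \<open>n\<close> is kept explicitly: it is not determined by \<open>\<pi>\<close>, which fixes every point
  outside \<open>{1..n}\<close>.\<close>

definition perm_class :: "(nat \<times> (nat \<Rightarrow> nat)) set" where
  "perm_class = {(n, \<pi>). \<pi> permutes {1..n} \<and> avoids231_on {1..n} \<pi> \<and> short_cycles {1..n} \<pi>}"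

definition perm_wt :: "nat \<times> (nat \<Rightarrow> nat) \<Rightarrow> nat \<times> nat \<times> nat" where
  "perm_wt = (\<lambda>(n, \<pi>). cycle_wt {1..n} \<pi>)"

lemma perm_class_iff:
  "(n, \<pi>) \<in> perm_class \<longleftrightarrow>
    \<pi> permutes {1..n} \<and> avoids231_on {1..n} \<pi> \<and> short_cycles {1..n} \<pi>"
  by (simp add: perm_class_def)

section \<open>Translation of the given definitions into \<open>perm_class\<close> and
  \<open>perm_wt\<close>\<close>

lemma avoids231_iff: "avoids231 n \<pi> \<longleftrightarrow> avoids231_on {1..n} \<pi>"
proof
  assume "avoids231 n \<pi>"
  then have "\<pi> i \<le> \<pi> k" if "1 \<le> i" "i < j" "j < k" "k \<le> n" "\<pi> i < \<pi> j" for i j k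
    using that leI unfolding avoids231_def by blast
  then show "avoids231_on {1..n} \<pi>"
    unfolding avoids231_on_def Ball_def atLeastAtMost_iff by blast
next
  assume av: "avoids231_on {1..n} \<pi>"
  show "avoids231 n \<pi>"
    unfolding avoids231_def
  proof clarify
    fix i j k assume "1 \<le> i" "i < j" "j < k" "k \<le> n" "\<pi> k < \<pi> i" "\<pi> i < \<pi> j"
    then show False by (intro avoids231_onD[OF av, of i j k]) auto
  qed
qed

lemma S3_231_eq: "S3_231 n = {\<pi>. (n, \<pi>) \<in> perm_class}"
proof -
  have "card (orbit \<pi> i) \<in> {1, 2, 3} \<longleftrightarrow> \<pi> i = i \<or> \<pi> (\<pi> i) = i \<or> \<pi> (\<pi> (\<pi> i)) = i"
    if "\<pi> permutes {1..n}" for \<pi> i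
    by (simp only: insert_iff empty_iff card_orbit_eq_123[OF that] simp_thms) argo
  then have "(\<forall>i\<in>{1..n}. card (orbit \<pi> i) \<in> {1, 2, 3}) \<longleftrightarrow> short_cycles {1..n} \<pi>"
    if "\<pi> permutes {1..n}" for \<pi>
    using that by (simp only: short_cycles_def)
  then show ?thesis
    unfolding S3_231_def perm_class_iff avoids231_iff by (intro Collect_cong conj_cong refl)
qed

lemma perm_wt_eq_ncycles:
  assumes "\<pi> permutes {1..n}"
  shows "perm_wt (n, \<pi>) = (ncycles 1 n \<pi>, ncycles 2 n \<pi>, ncycles 3 n \<pi>)"
proof -
  have "k * m div k = m" if "k > 0" for k m :: nat using that by simp
  then show ?thesis
    by (simp only: perm_wt_def cycle_wt_def ncycles_def card_orbit_eq_123[OF assms]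
        card_2cycle_points[OF assms] card_3cycle_points[OF assms] prod.case div_by_1 zero_less_numeral)
qed

text \<open>The points of \<open>{1..n}\<close> are sorted by the length of their cycle. Hence the
  weight determines the size, which makes the fibres finite and matches the size fixed in
  \<open>Bcoeff\<close>.\<close>

lemma size_eq_perm_wt:
  assumes "(n, \<pi>) \<in> perm_class" "perm_wt (n, \<pi>) = (a, b, c)"
  shows "n = a + 2 * b + 3 * c"
proof -
  have per: "\<pi> permutes {1..n}" and short: "short_cycles {1..n} \<pi>"
    using assms by (auto simp: perm_class_iff)
  let ?A = "{i \<in> {1..n}. \<pi> i = i}" and ?B = "{i \<in> {1..n}. \<pi> i \<noteq> i \<and> \<pi> (\<pi> i) = i}"
    and ?C = "{i \<in> {1..n}. \<pi> i \<noteq> i \<and> \<pi> (\<pi> (\<pi> i)) = i}"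
  have "{1..n} = ?A \<union> (?B \<union> ?C)"
    using short unfolding short_cycles_def by blast
  then have "n = card (?A \<union> (?B \<union> ?C))" by (metis card_atLeastAtMost diff_Suc_1)
  also have "\<dots> = card ?A + card (?B \<union> ?C)"
    by (rule card_Un_disjoint) auto
  also have "card (?B \<union> ?C) = card ?B + card ?C"
    by (rule card_Un_disjoint) auto
  finally show ?thesis
    using assms(2) unfolding card_2cycle_points[OF per] card_3cycle_points[OF per]
    by (simp add: perm_wt_def cycle_wt_def)
qed

lemma finite_fibres_perm_class: "finite_fibres perm_wt perm_class"
  unfolding finite_fibres_def
proof
  fix v :: "nat \<times> nat \<times> nat"
  obtain a b c where v: "v = (a, b, c)" by (cases v) auto
  let ?n = "a + 2 * b + 3 * c"
  have "{s \<in> perm_class. perm_wt s = v} \<subseteq> {?n} \<times> {\<pi>. \<pi> permutes {1..?n}}"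
    using size_eq_perm_wt[of _ _ a b c] unfolding v by (auto simp: perm_class_iff)
  then show "finite {s \<in> perm_class. perm_wt s = v}"
    by (rule finite_subset) (simp add: finite_permutations)
qed

lemma Bseries_eq_gf: "Bseries = gf perm_wt perm_class"
proof (rule fps3_eqI)
  fix a b c :: nat
  let ?n = "a + 2 * b + 3 * c"
  have "{s \<in> perm_class. perm_wt s = (a, b, c)} =
      Pair ?n ` {\<pi> \<in> S3_231 ?n. ncycles 1 ?n \<pi> = a \<and> ncycles 2 ?n \<pi> = b \<and> ncycles 3 ?n \<pi> = c}"
    (is "?L = Pair ?n ` ?R")
  proof
    show "Pair ?n ` ?R \<subseteq> ?L"
      using perm_wt_eq_ncycles[of _ ?n] by (auto simp: S3_231_eq perm_class_iff)
    show "?L \<subseteq> Pair ?n ` ?R"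
    proof
      fix s assume s: "s \<in> ?L"
      obtain n \<pi> where "s = (n, \<pi>)" by (cases s)
      with s size_eq_perm_wt[of n \<pi> a b c] have
        "s = (?n, \<pi>)" "(?n, \<pi>) \<in> perm_class" "perm_wt (?n, \<pi>) = (a, b, c)" by auto
      then show "s \<in> Pair ?n ` ?R"
        using perm_wt_eq_ncycles[of \<pi> ?n] by (auto simp: S3_231_eq perm_class_iff)
    qed
  qed
  then show "Bseries $ c $ b $ a = gf perm_wt perm_class $ c $ b $ a"
    by (simp add: gf_nth Bseries_def Bcoeff_def card_image inj_on_def)
qed

section \<open>Direct sums\<close>

lemma two_blocks_dsum: "two_blocks (r + s) r s (\<lambda>i. i) (\<lambda>i. r + i)"
proof
  have "(\<lambda>i. r + i) ` {1..s} = {r + 1..r + s}" by (simp add: image_add_atLeastAtMost)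
  then show "(\<lambda>i. i) ` {1..r} \<union> (\<lambda>i. r + i) ` {1..s} = {1..r + s}" by auto
qed (auto simp: strict_mono_on_def)

definition dsum :: "nat \<Rightarrow> nat \<Rightarrow> (nat \<Rightarrow> nat) \<Rightarrow> (nat \<Rightarrow> nat) \<Rightarrow> nat \<Rightarrow> nat" where
  "dsum r s = two_blocks.glue r s (\<lambda>i. i) (\<lambda>i. r + i)"

lemmas dsum_permutes = two_blocks.glue_permutes[OF two_blocks_dsum, folded dsum_def]
  and dsum_inject = two_blocks.glue_inject[OF two_blocks_dsum, folded dsum_def]
  and cycle_wt_dsum = two_blocks.cycle_wt_glue[OF two_blocks_dsum, folded dsum_def]
  and short_cycles_dsum = two_blocks.short_cycles_glue[OF two_blocks_dsum, folded dsum_def]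

lemma dsum_left: "i \<in> {1..r} \<Longrightarrow> dsum r s \<sigma> \<tau> i = \<sigma> i"
  using two_blocks.glue_g[OF two_blocks_dsum] by (simp only: dsum_def)

lemma dsum_right: "i \<in> {1..s} \<Longrightarrow> dsum r s \<sigma> \<tau> (r + i) = r + \<tau> i"
  using two_blocks.glue_h[OF two_blocks_dsum] by (simp only: dsum_def)

lemma dsum_cases:
  assumes "\<pi> permutes {1..r + s}" "\<And>i. i \<in> {1..r} \<Longrightarrow> \<pi> i \<in> {1..r}"
  obtains \<sigma> \<tau> where "\<sigma> permutes {1..r}" "\<tau> permutes {1..s}" "\<pi> = dsum r s \<sigma> \<tau>"
proof -
  have "\<pi> ` (\<lambda>i. i) ` {1..r} \<subseteq> (\<lambda>i. i) ` {1..r}"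
    unfolding image_ident using assms(2) by (rule image_subsetI)
  from two_blocks.glue_cases[OF two_blocks_dsum assms(1) this] that show thesis
    unfolding dsum_def by blast
qed

lemma avoids231_on_subset: "avoids231_on A \<pi> \<Longrightarrow> B \<subseteq> A \<Longrightarrow> avoids231_on B \<pi>"
  unfolding avoids231_on_def by (meson subsetD)

text \<open>A pattern meeting both summands would have its last, smallest entry in the right one and
  its first entry in the left one, but all right entries exceed all left ones.\<close>

lemma avoids231_on_dsum:
  assumes "\<sigma> permutes {1..r}" "\<tau> permutes {1..s}"
  shows "avoids231_on {1..r + s} (dsum r s \<sigma> \<tau>) \<longleftrightarrow> avoids231_on {1..r} \<sigma> \<and> avoids231_on {1..s} \<tau>"
proof -
  let ?\<pi> = "dsum r s \<sigma> \<tau>"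
  have img: "(\<lambda>i. r + i) ` {1..s} = {r + 1..r + s}" by (simp add: image_add_atLeastAtMost)
  have left: "avoids231_on {1..r} ?\<pi> \<longleftrightarrow> avoids231_on {1..r} \<sigma>"
    using two_blocks.avoids231_on_block_g[OF two_blocks_dsum assms]
    by (simp only: image_ident dsum_def)
  have right: "avoids231_on {r + 1..r + s} ?\<pi> \<longleftrightarrow> avoids231_on {1..s} \<tau>"
    using two_blocks.avoids231_on_block_h[OF two_blocks_dsum assms]
    by (simp only: img dsum_def)
  have le: "?\<pi> i \<le> r" if "i \<in> {1..r}" for i
    using permutes_in_image[OF assms(1), of i] that by (simp add: dsum_left)
  have ge: "r < ?\<pi> i" if "i \<in> {r + 1..r + s}" for i
  proof -
    from that img obtain j where "j \<in> {1..s}" "i = r + j" by blast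
    then show ?thesis
      using permutes_in_image[OF assms(2), of j] by (simp add: dsum_right)
  qed
  have "avoids231_on {1..r + s} ?\<pi>"
    if avl: "avoids231_on {1..r} ?\<pi>" and avr: "avoids231_on {r + 1..r + s} ?\<pi>"
    unfolding avoids231_on_def
  proof (intro ballI impI)
    fix i j k assume ijk: "i \<in> {1..r + s}" "j \<in> {1..r + s}" "k \<in> {1..r + s}"
      "i < j \<and> j < k \<and> ?\<pi> i < ?\<pi> j"
    consider "k \<le> r" | "r < i" | "i \<le> r" "r < k" by linarith
    then show "?\<pi> i \<le> ?\<pi> k"
    proof cases
      case 1
      with ijk have "i \<in> {1..r}" "j \<in> {1..r}" "k \<in> {1..r}" by auto
      with avl ijk(4) show ?thesis unfolding avoids231_on_def by blast
    next
      case 2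
      with ijk have "i \<in> {r + 1..r + s}" "j \<in> {r + 1..r + s}" "k \<in> {r + 1..r + s}" by auto
      with avr ijk(4) show ?thesis unfolding avoids231_on_def by blast
    next
      case 3
      then show ?thesis using le[of i] ge[of k] ijk by auto
    qed
  qed
  moreover have "avoids231_on {1..r} ?\<pi>" "avoids231_on {r + 1..r + s} ?\<pi>"
    if "avoids231_on {1..r + s} ?\<pi>"
    using that by (rule avoids231_on_subset; auto)+
  ultimately show ?thesis unfolding left right by blast
qed

lemma perm_class_dsum:
  assumes "\<sigma> permutes {1..r}" "\<tau> permutes {1..s}"
  shows "(r + s, dsum r s \<sigma> \<tau>) \<in> perm_class \<longleftrightarrow> (r, \<sigma>) \<in> perm_class \<and> (s, \<tau>) \<in> perm_class"
  using assms dsum_permutes[OF assms]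
  by (auto simp only: perm_class_iff avoids231_on_dsum[OF assms] short_cycles_dsum[OF assms])

lemma perm_wt_dsum:
  assumes "\<sigma> permutes {1..r}" "\<tau> permutes {1..s}"
  shows "perm_wt (r + s, dsum r s \<sigma> \<tau>) = perm_wt (r, \<sigma>) + perm_wt (s, \<tau>)"
  by (simp only: perm_wt_def prod.case cycle_wt_dsum[OF assms])

section \<open>Splitting off the part left of the maximum\<close>

definition top_class :: "(nat \<times> (nat \<Rightarrow> nat)) set" where
  "top_class = {(n, \<pi>) \<in> perm_class. 1 \<le> n \<and> \<pi> 1 = n}"

lemma top_class_iff: "(n, \<pi>) \<in> top_class \<longleftrightarrow> (n, \<pi>) \<in> perm_class \<and> 1 \<le> n \<and> \<pi> 1 = n"
  by (simp add: top_class_def)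

text \<open>In a 231-avoider every entry to the left of the maximum is smaller than every entry to its
  right, so the part left of the maximum splits off as a direct summand.\<close>

lemma bij_betw_dsum:
  "bij_betw (\<lambda>((r, \<sigma>), (s, \<tau>)). (r + s, dsum r s \<sigma> \<tau>)) (perm_class \<times> top_class)
    {(n, \<pi>) \<in> perm_class. 1 \<le> n}"
  (is "bij_betw ?F ?S ?T")
proof (rule bij_betw_imageI)
  show "inj_on ?F ?S"
  proof (rule inj_onI)
    fix u v assume uv: "u \<in> ?S" "v \<in> ?S" "?F u = ?F v"
    obtain r \<sigma> s \<tau> where u: "u = ((r, \<sigma>), (s, \<tau>))" by (metis surj_pair)
    obtain r' \<sigma>' s' \<tau>' where v: "v = ((r', \<sigma>'), (s', \<tau>'))" by (metis surj_pair)
    have perm: "\<sigma> permutes {1..r}" "\<tau> permutes {1..s}" "\<sigma>' permutes {1..r'}" "\<tau>' permutes {1..s'}"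
      and top: "1 \<le> s" "\<tau> 1 = s" "1 \<le> s'" "\<tau>' 1 = s'"
      using uv(1,2) unfolding u v by (auto simp: top_class_iff perm_class_iff)
    have n: "r + s = r' + s'" and eq: "dsum r s \<sigma> \<tau> = dsum r' s' \<sigma>' \<tau>'"
      using uv(3) unfolding u v by auto
    \<comment> \<open>Position \<open>r + 1\<close> carries the maximal entry, so \<open>r\<close>
      can be recovered from the direct sum.\<close>
    have "dsum r s \<sigma> \<tau> (r + 1) = r + s" "dsum r' s' \<sigma>' \<tau>' (r' + 1) = r' + s'"
      using top dsum_right[of 1 s r] dsum_right[of 1 s' r'] by simp_all
    then have "dsum r s \<sigma> \<tau> (r + 1) = dsum r s \<sigma> \<tau> (r' + 1)"
      using n eq by simp
    then have r: "r' = r"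
      using permutes_inj[OF dsum_permutes[OF perm(1,2)]] by (simp add: inj_eq)
    with n have s: "s' = s" by simp
    show "u = v"
      using dsum_inject[OF perm(1,2) perm(3,4)[unfolded r s] eq[unfolded r s]]
      unfolding u v r s by simp
  qed
  show "?F ` ?S = ?T"
  proof
    show "?F ` ?S \<subseteq> ?T"
    proof
      fix v assume "v \<in> ?F ` ?S"
      then obtain r \<sigma> s \<tau> where "v = (r + s, dsum r s \<sigma> \<tau>)" "(r, \<sigma>) \<in> perm_class" "(s, \<tau>) \<in> top_class"
        by auto
      then show "v \<in> ?T"
        using perm_class_dsum[of \<sigma> r \<tau> s] by (auto simp: top_class_iff perm_class_iff)
    qed
    show "?T \<subseteq> ?F ` ?S"
    proof
      fix v assume "v \<in> ?T"
      then obtain n \<pi> where v: "v = (n, \<pi>)" "(n, \<pi>) \<in> perm_class" "1 \<le> n" by auto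
      then have perm: "\<pi> permutes {1..n}" and av: "avoids231_on {1..n} \<pi>"
        by (auto simp: perm_class_iff)
      have "n \<in> \<pi> ` {1..n}" using permutes_image[OF perm] v(3) by simp
      then obtain q where q: "q \<in> {1..n}" "\<pi> q = n" by auto
      \<comment> \<open>\<open>r\<close> is the number of entries to the left of the maximum, which
        sits at position \<open>q\<close>.\<close>
      define r s where "r = q - 1" and "s = n - r"
      have n: "n = r + s" and q': "q = r + 1" and s: "1 \<le> s" using q by (auto simp: r_def s_def)
      have mem: "\<pi> i \<in> {1..n}" if "i \<in> {1..n}" for i
        using permutes_in_image[OF perm] that by blast
      have inj: "\<pi> i \<noteq> \<pi> j" if "i \<noteq> j" for i j
        using permutes_inj[OF perm] that by (simp add: inj_eq)
      have below: "\<pi> i \<in> {1..r}" if i: "i \<in> {1..r}" for i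
      proof -
        have in_n: "i \<in> {1..n}" using i n by simp
        have "\<pi> l \<in> {\<pi> i + 1..n}" if l: "l \<in> {q..n}" for l
        proof -
          have "l \<in> {1..n}" using l q by auto
          have "\<pi> i < \<pi> q" using mem[OF in_n] inj[of i q] i q q' by auto
          \<comment> \<open>Otherwise the positions \<open>i\<close>, \<open>q\<close>,
            \<open>l\<close> would carry a 231 pattern.\<close>
          have "\<not> \<pi> l < \<pi> i"
          proof
            assume less: "\<pi> l < \<pi> i"
            then have "q < l" using \<open>\<pi> i < \<pi> q\<close> l by (cases "q = l") auto
            with less \<open>\<pi> i < \<pi> q\<close> in_n q(1) \<open>l \<in> {1..n}\<close> i q' show False
              using avoids231_onD[OF av, of i q l] by auto
          qed
          moreover have "\<pi> l \<noteq> \<pi> i" using inj l i q' by auto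
          ultimately show ?thesis using mem[OF \<open>l \<in> {1..n}\<close>] by auto
        qed
        \<comment> \<open>The \<open>s\<close> entries from position \<open>q\<close> on all lie
          above \<open>\<pi> i\<close>, so counting them gives
          \<open>\<pi> i \<le> n - s = r\<close>.\<close>
        then have "\<pi> ` {q..n} \<subseteq> {\<pi> i + 1..n}" by blast
        then have "card (\<pi> ` {q..n}) \<le> card {\<pi> i + 1..n}" by (intro card_mono) auto
        moreover have "card (\<pi> ` {q..n}) = card {q..n}"
          using permutes_inj_on[OF perm] by (rule card_image)
        ultimately have "\<pi> i \<le> r" using mem[OF in_n] q' n s by simp
        then show ?thesis using mem[OF in_n] by auto
      qed
      obtain \<sigma> \<tau> where \<sigma>\<tau>: "\<sigma> permutes {1..r}" "\<tau> permutes {1..s}" "\<pi> = dsum r s \<sigma> \<tau>"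
        using dsum_cases[OF perm[unfolded n] below] by blast
      have "\<tau> 1 = s"
        using q(2) dsum_right[of 1 s r \<sigma> \<tau>] s unfolding \<sigma>\<tau>(3) q' n by simp
      moreover have "(r, \<sigma>) \<in> perm_class" "(s, \<tau>) \<in> perm_class"
        using v(2) unfolding n \<sigma>\<tau>(3) perm_class_dsum[OF \<sigma>\<tau>(1,2)] by auto
      ultimately have "((r, \<sigma>), (s, \<tau>)) \<in> ?S" using s by (simp add: top_class_iff)
      moreover have "v = ?F ((r, \<sigma>), (s, \<tau>))" using v(1) n \<sigma>\<tau>(3) by simp
      ultimately show "v \<in> ?F ` ?S" by blast
    qed
  qed
qed

lemma finite_fibres_top_class: "finite_fibres perm_wt top_class"
  by (rule finite_fibres_subset[OF finite_fibres_perm_class]) (auto simp: top_class_def)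

text \<open>The summand 1 is the empty permutation; all others decompose uniquely by
  \<open>bij_betw_dsum\<close>.\<close>

lemma gf_perm_class: "gf perm_wt perm_class = 1 + gf perm_wt perm_class * gf perm_wt top_class"
proof -
  let ?T = "{(n, \<pi>) \<in> perm_class. 1 \<le> n}"
  have empty: "(0, id) \<in> perm_class"
    by (auto simp: perm_class_iff avoids231_on_def short_cycles_def permutes_id)
  have split: "perm_class = {(0, id)} \<union> ?T"
  proof
    show "perm_class \<subseteq> {(0, id)} \<union> ?T"
    proof
      fix v assume v: "v \<in> perm_class"
      obtain n \<pi> where n: "v = (n, \<pi>)" by (cases v)
      show "v \<in> {(0, id)} \<union> ?T"
        using v unfolding n by (cases n) (auto simp: perm_class_iff)
    qed
  qed (use empty in auto)
  have "gf perm_wt perm_class = gf perm_wt {(0, id)} + gf perm_wt ?T"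
    using gf_Un[of perm_wt "{(0, id)}" ?T] finite_fibres_perm_class unfolding split[symmetric] by simp
  also have "gf perm_wt {(0, id)} = 1"
    by (rule gf_singleton) (auto simp: perm_wt_def cycle_wt_def)
  also have "gf perm_wt ?T = gf (\<lambda>(s, t). perm_wt s + perm_wt t) (perm_class \<times> top_class)"
    by (rule gf_cong[OF bij_betw_dsum, symmetric])
      (auto simp: perm_wt_dsum top_class_iff perm_class_iff)
  also have "\<dots> = gf perm_wt perm_class * gf perm_wt top_class"
    by (rule gf_times[OF finite_fibres_perm_class finite_fibres_top_class])
  finally show ?thesis .
qed

section \<open>Decreasing permutations\<close>

definition dec :: "nat \<Rightarrow> nat \<Rightarrow> nat" where
  "dec n i = (if i \<in> {1..n} then n + 1 - i else i)"

lemma dec_permutes: "dec n permutes {1..n}"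
proof (rule bij_imp_permutes)
  show "bij_betw (dec n) {1..n} {1..n}"
    by (rule bij_betw_byWitness[where f' = "dec n"]) (auto simp: dec_def)
qed (auto simp: dec_def)

lemma dec_in_perm_class: "(n, dec n) \<in> perm_class"
  using dec_permutes by (auto simp: perm_class_iff avoids231_on_def short_cycles_def dec_def)

definition dec_wt :: "nat \<Rightarrow> nat \<times> nat \<times> nat" where
  "dec_wt n = (n mod 2, n div 2, 0)"

text \<open>Reversal swaps \<open>i\<close> with \<open>n + 1 - i\<close>, so its 2-cycles have
  least elements \<open>1\<close> to \<open>n div 2\<close>, and the middle point is fixed exactly
  for odd \<open>n\<close>.\<close>

lemma perm_wt_dec: "perm_wt (n, dec n) = dec_wt n"
proof -
  have "{i \<in> {1..n}. dec n i = i} = (if odd n then {(n + 1) div 2} else {})"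
    by (auto simp: dec_def; presburger)
  moreover have "{i \<in> {1..n}. i < dec n i \<and> dec n (dec n i) = i} = {1..n div 2}"
    by (auto simp: dec_def)
  moreover have "{i \<in> {1..n}. i < dec n i \<and> i < dec n (dec n i) \<and> dec n (dec n (dec n i)) = i} = {}"
    by (auto simp: dec_def)
  ultimately show ?thesis
    by (simp add: perm_wt_def cycle_wt_def dec_wt_def odd_iff_mod_2_eq_one)
qed

lemma decreasing_imp_dec:
  assumes perm: "\<pi> permutes {1..n}"
    and decr: "\<And>i j. 1 \<le> i \<Longrightarrow> i < j \<Longrightarrow> j \<le> n \<Longrightarrow> \<pi> j < \<pi> i"
  shows "\<pi> = dec n"
proof
  have mem: "\<pi> i \<in> {1..n}" if "i \<in> {1..n}" for i
    using permutes_in_image[OF perm] that by blast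
  \<comment> \<open>Descending strictly from position 1 bounds the entries from above, and climbing
    back from position \<open>n\<close> bounds them from below; the two bounds meet.\<close>
  have upper: "Suc i \<le> n \<Longrightarrow> \<pi> (Suc i) + i \<le> n" for i
  proof (induction i)
    case 0
    then show ?case using mem[of 1] by auto
  next
    case (Suc i)
    then show ?case using decr[of "Suc i" "Suc (Suc i)"] by auto
  qed
  have lower: "k < n \<Longrightarrow> k + 1 \<le> \<pi> (n - k)" for k
  proof (induction k)
    case 0
    then show ?case using mem[of n] by auto
  next
    case (Suc k)
    then have "\<pi> (n - k) < \<pi> (n - Suc k)" by (intro decr) auto
    then show ?case using Suc by simp
  qed
  fix i
  show "\<pi> i = dec n i"
  proof (cases "i \<in> {1..n}")
    case True
    then show ?thesis using upper[of "i - 1"] lower[of "n - i"] by (auto simp: dec_def)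
  next
    case False
    then show ?thesis using permutes_not_in[OF perm] by (auto simp: dec_def)
  qed
qed

section \<open>Inserting a 3-cycle\<close>

text \<open>The condition \<open>\<pi> n \<noteq> 1\<close> rules out both \<open>n = 1\<close> and
  the 2-cycle exchanging 1 and \<open>n\<close>; a 3-cycle through 1 and \<open>n\<close>
  remains.\<close>

definition cyc3_class :: "(nat \<times> (nat \<Rightarrow> nat)) set" where
  "cyc3_class = {(n, \<pi>) \<in> top_class. \<pi> n \<noteq> 1}"

lemma dec_in_top_class: "1 \<le> n \<Longrightarrow> (n, dec n) \<in> top_class"
  using dec_in_perm_class by (simp add: top_class_iff dec_def)

text \<open>Any ascent before the final entry 1 would complete a 231 pattern.\<close>

lemma last_eq_1_imp_dec:
  assumes "\<pi> permutes {1..n}" "avoids231_on {1..n} \<pi>" "\<pi> n = 1"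
  shows "\<pi> = dec n"
proof (rule decreasing_imp_dec[OF assms(1)])
  fix i j assume ij: "1 \<le> i" "i < j" "j \<le> n"
  have inj: "\<pi> u \<noteq> \<pi> v" if "u \<noteq> v" for u v
    using permutes_inj[OF assms(1)] that by (simp add: inj_eq)
  have "\<pi> i \<in> {1..n}" using permutes_in_image[OF assms(1), of i] ij by simp
  then have gt: "\<pi> n < \<pi> i" using inj[of i n] ij assms(3) by auto
  show "\<pi> j < \<pi> i"
  proof (rule ccontr)
    assume "\<not> \<pi> j < \<pi> i"
    then have "\<pi> i < \<pi> j" using inj[of i j] ij by auto
    moreover from this gt have "j < n" using ij by (cases "j = n") auto
    ultimately show False using avoids231_onD[OF assms(2), of i j n] gt ij by auto
  qed
qed

lemma top_class_split: "top_class = (\<lambda>n. (n, dec n)) ` {1..} \<union> cyc3_class"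
proof
  show "top_class \<subseteq> (\<lambda>n. (n, dec n)) ` {1..} \<union> cyc3_class"
  proof
    fix v assume v: "v \<in> top_class"
    obtain n \<pi> where n: "v = (n, \<pi>)" by (cases v)
    show "v \<in> (\<lambda>n. (n, dec n)) ` {1..} \<union> cyc3_class"
      using v last_eq_1_imp_dec[of \<pi> n] unfolding n
      by (cases "\<pi> n = 1") (auto simp: cyc3_class_def top_class_iff perm_class_iff)
  qed
  show "(\<lambda>n. (n, dec n)) ` {1..} \<union> cyc3_class \<subseteq> top_class"
    using dec_in_top_class by (auto simp: cyc3_class_def)
qed

lemma dec_not_in_cyc3_class: "(n, dec n) \<notin> cyc3_class"
  by (auto simp: cyc3_class_def top_class_iff dec_def)

lemma cyc3_classD:
  assumes "(n, \<pi>) \<in> cyc3_class"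
  shows "\<pi> permutes {1..n}" "avoids231_on {1..n} \<pi>" "\<pi> 1 = n" "\<pi> (\<pi> n) = 1" "1 < \<pi> n" "\<pi> n < n"
proof -
  have n: "1 \<le> n" "\<pi> 1 = n" "\<pi> n \<noteq> 1"
    and perm: "\<pi> permutes {1..n}" and av: "avoids231_on {1..n} \<pi>"
    and short: "short_cycles {1..n} \<pi>"
    using assms by (auto simp: cyc3_class_def top_class_iff perm_class_iff)
  have inj: "\<pi> u \<noteq> \<pi> v" if "u \<noteq> v" for u v
    using permutes_inj[OF perm] that by (simp add: inj_eq)
  have "\<pi> n \<in> {1..n}" using permutes_in_image[OF perm, of n] n by simp
  moreover have "n \<noteq> 1" using n by auto
  moreover from this have "\<pi> n \<noteq> n" using inj[of n 1] n by simp
  ultimately show "1 < \<pi> n" "\<pi> n < n" using n by auto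
  have "\<pi> 1 = 1 \<or> \<pi> (\<pi> 1) = 1 \<or> \<pi> (\<pi> (\<pi> 1)) = 1"
    using short n(1) by (auto simp: short_cycles_def)
  then show "\<pi> (\<pi> n) = 1" using n \<open>n \<noteq> 1\<close> by auto
qed (use assms in \<open>auto simp: cyc3_class_def top_class_iff perm_class_iff\<close>)

text \<open>The condition under which a new 3-cycle can be wrapped around \<open>\<sigma>\<close> at height \<open>p\<close>: the new
  entry 1 is placed right after the first \<open>p\<close> entries of \<open>\<sigma>\<close>, which must therefore decrease, and the
  new last entry lies just above the value \<open>p\<close>, so the entries exceeding \<open>p\<close> must decrease as well.\<close>

definition cut_class :: "((nat \<times> (nat \<Rightarrow> nat)) \<times> nat) set" where
  "cut_class = {((r, \<sigma>), p). (r, \<sigma>) \<in> perm_class \<and> p \<le> r \<and>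
     (\<forall>i j. 1 \<le> i \<and> i < j \<and> j \<le> p \<longrightarrow> \<sigma> j < \<sigma> i) \<and>
     (\<forall>i j. 1 \<le> i \<and> i < j \<and> j \<le> r \<and> p < \<sigma> i \<and> p < \<sigma> j \<longrightarrow> \<sigma> j < \<sigma> i)}"

lemma cut_class_iff:
  "((r, \<sigma>), p) \<in> cut_class \<longleftrightarrow> (r, \<sigma>) \<in> perm_class \<and> p \<le> r \<and>
     (\<forall>i j. 1 \<le> i \<and> i < j \<and> j \<le> p \<longrightarrow> \<sigma> j < \<sigma> i) \<and>
     (\<forall>i j. 1 \<le> i \<and> i < j \<and> j \<le> r \<and> p < \<sigma> i \<and> p < \<sigma> j \<longrightarrow> \<sigma> j < \<sigma> i)"
  by (simp add: cut_class_def)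

text \<open>On \<open>{1..r}\<close> the increasing enumeration of the positions, and equally of the
  values, other than the new points 1, \<open>p + 2\<close> and \<open>r + 3\<close>, which
  \<open>rim\<close> enumerates.\<close>

definition skip :: "nat \<Rightarrow> nat \<Rightarrow> nat" where
  "skip p i = (if i \<le> p then i + 1 else i + 2)"

definition rim :: "nat \<Rightarrow> nat \<Rightarrow> nat \<Rightarrow> nat" where
  "rim r p i = (if i \<le> 1 then 1 else if i = 2 then p + 2 else r + 3)"

definition rot3 :: "nat \<Rightarrow> nat" where
  "rot3 = id(1 := 3, 2 := 1, 3 := 2)"

lemma atLeastAtMost_1_3: "{1..3} = {1, 2, 3::nat}"
  by auto

lemma skip_less_iff: "skip p i < skip p j \<longleftrightarrow> i < j"
  by (auto simp: skip_def)

lemma skip_image: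
  assumes "p \<le> r"
  shows "skip p ` {1..r} = {1..r + 3} - {1, p + 2, r + 3}"
proof
  show "skip p ` {1..r} \<subseteq> {1..r + 3} - {1, p + 2, r + 3}"
    using assms by (auto simp: skip_def)
  show "{1..r + 3} - {1, p + 2, r + 3} \<subseteq> skip p ` {1..r}"
  proof
    fix u assume u: "u \<in> {1..r + 3} - {1, p + 2, r + 3}"
    then have "u = skip p (if u < p + 2 then u - 1 else u - 2)"
      by (auto simp: skip_def)
    moreover have "(if u < p + 2 then u - 1 else u - 2) \<in> {1..r}" using u assms by auto
    ultimately show "u \<in> skip p ` {1..r}" by blast
  qed
qed

lemma rim_image: "rim r p ` {1..3} = {1, p + 2, r + 3}"
  unfolding atLeastAtMost_1_3 by (auto simp: rim_def)

lemma two_blocks_insert: "p \<le> r \<Longrightarrow> two_blocks (r + 3) r 3 (skip p) (rim r p)"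
proof
  assume p: "p \<le> r"
  show "strict_mono_on {1..r} (skip p)" by (simp add: strict_mono_on_def skip_less_iff)
  show "strict_mono_on {1..3} (rim r p)" using p by (auto simp: strict_mono_on_def rim_def)
  show "skip p ` {1..r} \<union> rim r p ` {1..3} = {1..r + 3}"
    unfolding skip_image[OF p] rim_image using p by auto
  show "skip p ` {1..r} \<inter> rim r p ` {1..3} = {}"
    unfolding skip_image[OF p] rim_image by auto
qed

lemma rot3_permutes: "rot3 permutes {1..3}"
proof (rule bij_imp_permutes)
  show "bij_betw rot3 {1..3} {1..3}"
    unfolding atLeastAtMost_1_3 by (auto simp: bij_betw_def rot3_def)
qed (auto simp: rot3_def)

lemma short_cycles_rot3: "short_cycles {1..3} rot3"
  unfolding atLeastAtMost_1_3 by (auto simp: short_cycles_def rot3_def)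

lemma cycle_wt_rot3: "cycle_wt {1..3} rot3 = (0, 0, 1)"
proof -
  have "{i \<in> {1..3}. rot3 i = i} = {}" "{i \<in> {1..3}. i < rot3 i \<and> rot3 (rot3 i) = i} = {}"
    "{i \<in> {1..3}. i < rot3 i \<and> i < rot3 (rot3 i) \<and> rot3 (rot3 (rot3 i)) = i} = {1}"
    unfolding atLeastAtMost_1_3 by (auto simp: rot3_def)
  then show ?thesis by (simp add: cycle_wt_def)
qed

text \<open>The new 3-cycle is \<open>1 \<mapsto> r + 3 \<mapsto> p + 2 \<mapsto> 1\<close>.\<close>

definition insert3 :: "nat \<Rightarrow> nat \<Rightarrow> (nat \<Rightarrow> nat) \<Rightarrow> nat \<Rightarrow> nat" where
  "insert3 r p \<sigma> = two_blocks.glue r 3 (skip p) (rim r p) \<sigma> rot3"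

context
  fixes r p :: nat
  assumes p: "p \<le> r"
begin

interpretation two_blocks "r + 3" r 3 "skip p" "rim r p"
  using p by (rule two_blocks_insert)

lemma insert3_skip: "i \<in> {1..r} \<Longrightarrow> insert3 r p \<sigma> (skip p i) = skip p (\<sigma> i)"
  unfolding insert3_def by (rule glue_g)

lemma insert3_rim:
  "insert3 r p \<sigma> 1 = r + 3" "insert3 r p \<sigma> (p + 2) = 1" "insert3 r p \<sigma> (r + 3) = p + 2"
  unfolding insert3_def
  using glue_h[of 1 \<sigma> rot3] glue_h[of 2 \<sigma> rot3] glue_h[of 3 \<sigma> rot3]
  by (simp_all add: rim_def rot3_def)

lemma insert3_permutes: "\<sigma> permutes {1..r} \<Longrightarrow> insert3 r p \<sigma> permutes {1..r + 3}"
  unfolding insert3_def using rot3_permutes by (rule glue_permutes[rotated])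

lemma insert3_inject:
  "\<sigma> permutes {1..r} \<Longrightarrow> \<sigma>' permutes {1..r} \<Longrightarrow> insert3 r p \<sigma> = insert3 r p \<sigma>' \<Longrightarrow> \<sigma> = \<sigma>'"
  unfolding insert3_def using glue_inject[OF _ rot3_permutes _ rot3_permutes] by blast

lemma perm_wt_insert3:
  "\<sigma> permutes {1..r} \<Longrightarrow> perm_wt (r + 3, insert3 r p \<sigma>) = perm_wt (r, \<sigma>) + (0, 0, 1)"
  unfolding insert3_def perm_wt_def prod.case
  by (simp only: cycle_wt_glue[OF _ rot3_permutes] cycle_wt_rot3)

lemma short_cycles_insert3:
  "\<sigma> permutes {1..r} \<Longrightarrow> short_cycles {1..r + 3} (insert3 r p \<sigma>) \<longleftrightarrow> short_cycles {1..r} \<sigma>"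
  unfolding insert3_def
  by (simp only: short_cycles_glue[OF _ rot3_permutes] short_cycles_rot3 simp_thms)

lemma skip_cases:
  assumes "u \<in> {1..r + 3}"
  obtains "u = 1" | "u = p + 2" | "u = r + 3" | i where "i \<in> {1..r}" "u = skip p i"
  using assms skip_image[OF p] by blast

text \<open>A new entry can only play the last role of a 231 pattern: the first one is the maximum,
  the entry 1 is the minimum, and the third is in last place. The minimum at position
  \<open>p + 2\<close> forbids ascents among the first \<open>p\<close> entries of
  \<open>\<sigma>\<close>, the last entry \<open>p + 2\<close> forbids ascents among those above
  \<open>p\<close>.\<close>

lemma avoids231_on_insert3:
  assumes perm: "\<sigma> permutes {1..r}"
  shows "avoids231_on {1..r + 3} (insert3 r p \<sigma>) \<longleftrightarrow> avoids231_on {1..r} \<sigma> \<and>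
     (\<forall>i j. 1 \<le> i \<and> i < j \<and> j \<le> p \<longrightarrow> \<sigma> j < \<sigma> i) \<and>
     (\<forall>i j. 1 \<le> i \<and> i < j \<and> j \<le> r \<and> p < \<sigma> i \<and> p < \<sigma> j \<longrightarrow> \<sigma> j < \<sigma> i)"
    (is "_ \<longleftrightarrow> _ \<and> ?left \<and> ?high")
proof -
  define \<pi> where "\<pi> = insert3 r p \<sigma>"
  have block: "avoids231_on (skip p ` {1..r}) \<pi> \<longleftrightarrow> avoids231_on {1..r} \<sigma>"
    unfolding \<pi>_def insert3_def by (rule avoids231_on_block_g[OF perm rot3_permutes])
  have sub: "skip p ` {1..r} \<subseteq> {1..r + 3}"
    unfolding skip_image[OF p] by blast
  have mem: "\<sigma> i \<in> {1..r}" if "i \<in> {1..r}" for i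
    using permutes_in_image[OF perm] that by blast
  have inj: "\<sigma> i \<noteq> \<sigma> j" if "i \<noteq> j" for i j
    using permutes_inj[OF perm] that by (simp add: inj_eq)
  have in_range: "skip p i \<in> {1..r + 3}" if "i \<in> {1..r}" for i
    using sub that by blast
  have \<pi>_skip: "\<pi> (skip p i) = skip p (\<sigma> i)" if "i \<in> {1..r}" for i
    unfolding \<pi>_def by (rule insert3_skip[OF that])
  have \<pi>_rim: "\<pi> 1 = r + 3" "\<pi> (p + 2) = 1" "\<pi> (r + 3) = p + 2"
    unfolding \<pi>_def by (rule insert3_rim)+
  have \<pi>_mem: "\<pi> i \<in> {1..r + 3}" if "i \<in> {1..r + 3}" for i
    using permutes_in_image[OF insert3_permutes[OF perm]] that unfolding \<pi>_def by blast
  \<comment> \<open>Used twice: with \<open>i\<close> a position, compared with the place of the new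
    entry 1, and with \<open>i\<close> a value, compared with the new last entry.\<close>
  have low: "skip p i < p + 2 \<longleftrightarrow> i \<le> p" "p + 2 < skip p i \<longleftrightarrow> p < i" for i
    by (auto simp: skip_def)
  have bounds: "1 < skip p i" "skip p i < r + 3" if "i \<in> {1..r}" for i
    using that p by (auto simp: skip_def)
  show ?thesis
    unfolding \<pi>_def[symmetric]
  proof
    assume av: "avoids231_on {1..r + 3} \<pi>"
    have ?left
    proof (intro allI impI)
      fix i j assume ij: "1 \<le> i \<and> i < j \<and> j \<le> p"
      then have r: "i \<in> {1..r}" "j \<in> {1..r}" using p by auto
      show "\<sigma> j < \<sigma> i"
      proof (rule ccontr)
        assume "\<not> \<sigma> j < \<sigma> i"
        then have "\<sigma> i < \<sigma> j" using inj[of i j] ij by auto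
        show False
        proof (rule avoids231_onD[OF av, of "skip p i" "skip p j" "p + 2"])
          show "skip p i < skip p j" "skip p j < p + 2"
            using ij by (simp_all only: skip_less_iff low)
          show "\<pi> (p + 2) < \<pi> (skip p i)"
            using bounds(1)[OF mem[OF r(1)]] by (simp only: \<pi>_skip[OF r(1)] \<pi>_rim)
          show "\<pi> (skip p i) < \<pi> (skip p j)"
            using \<open>\<sigma> i < \<sigma> j\<close> by (simp only: \<pi>_skip r skip_less_iff)
        qed (use p in_range r in auto)
      qed
    qed
    moreover have ?high
    proof (intro allI impI)
      fix i j assume ij: "1 \<le> i \<and> i < j \<and> j \<le> r \<and> p < \<sigma> i \<and> p < \<sigma> j"
      then have r: "i \<in> {1..r}" "j \<in> {1..r}" by auto
      show "\<sigma> j < \<sigma> i"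
      proof (rule ccontr)
        assume "\<not> \<sigma> j < \<sigma> i"
        then have "\<sigma> i < \<sigma> j" using inj[of i j] ij by auto
        show False
        proof (rule avoids231_onD[OF av, of "skip p i" "skip p j" "r + 3"])
          show "skip p i < skip p j" "skip p j < r + 3"
            using ij bounds(2)[OF r(2)] by (simp_all only: skip_less_iff)
          show "\<pi> (r + 3) < \<pi> (skip p i)"
            using ij by (simp only: \<pi>_skip[OF r(1)] \<pi>_rim low)
          show "\<pi> (skip p i) < \<pi> (skip p j)"
            using \<open>\<sigma> i < \<sigma> j\<close> by (simp only: \<pi>_skip r skip_less_iff)
        qed (use in_range r in auto)
      qed
    qed
    ultimately show "avoids231_on {1..r} \<sigma> \<and> ?left \<and> ?high"
      using avoids231_on_subset[OF av sub] block by blast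
  next
    assume H: "avoids231_on {1..r} \<sigma> \<and> ?left \<and> ?high"
    then have left: "\<sigma> j < \<sigma> i" if "1 \<le> i" "i < j" "j \<le> p" for i j
      using that by blast
    from H have high: "\<sigma> j < \<sigma> i" if "1 \<le> i" "i < j" "j \<le> r" "p < \<sigma> i" "p < \<sigma> j" for i j
      using that by blast
    show "avoids231_on {1..r + 3} \<pi>"
      unfolding avoids231_on_def
    proof (intro ballI impI)
      fix u v w assume uvw: "u \<in> {1..r + 3}" "v \<in> {1..r + 3}" "w \<in> {1..r + 3}"
        "u < v \<and> v < w \<and> \<pi> u < \<pi> v"
      show "\<pi> u \<le> \<pi> w"
      proof (rule ccontr)
        assume "\<not> \<pi> u \<le> \<pi> w"
        then have 231: "\<pi> w < \<pi> u" "\<pi> u < \<pi> v" "u < v" "v < w" using uvw by auto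
        \<comment> \<open>The extreme values exclude \<open>u = 1\<close>, \<open>u = p + 2\<close>
          and \<open>v = p + 2\<close>; the order of positions excludes the other new points, so
          \<open>u\<close> and \<open>v\<close> come from \<open>\<sigma>\<close>.\<close>
        have "1 \<le> \<pi> w" "\<pi> v \<le> r + 3" using \<pi>_mem[OF uvw(2)] \<pi>_mem[OF uvw(3)] by auto
        then have "\<pi> u \<noteq> \<pi> 1" "\<pi> u \<noteq> \<pi> (p + 2)" "\<pi> v \<noteq> \<pi> (p + 2)"
          unfolding \<pi>_rim using 231 by linarith+
        then have "u \<noteq> 1" "u \<noteq> p + 2" "v \<noteq> p + 2" by blast+
        moreover have "u \<noteq> r + 3" "v \<noteq> 1" "v \<noteq> r + 3" using 231 uvw(1-3) by auto
        ultimately have "u \<in> skip p ` {1..r}" "v \<in> skip p ` {1..r}"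
          unfolding skip_image[OF p] using uvw(1,2) by blast+
        then obtain i j where i: "i \<in> {1..r}" "u = skip p i" and j: "j \<in> {1..r}" "v = skip p j"
          by blast
        have ij: "i < j" "\<sigma> i < \<sigma> j"
          using 231(3,2) unfolding i(2) j(2) \<pi>_skip[OF i(1)] \<pi>_skip[OF j(1)] skip_less_iff .
        from uvw(3) show False
        proof (cases w rule: skip_cases)
          case 1
          then show False using 231 by simp
        next
          case 2
          then have "j \<le> p" using 231(4) unfolding j(2) by (simp only: low)
          then show False using left[of i j] ij i(1) by simp
        next
          case 3
          then have "p < \<sigma> i"
            using 231(1) unfolding i(2) \<pi>_skip[OF i(1)] by (simp only: low \<pi>_rim)
          then show False using high[of i j] ij i(1) j(1) by simp
        next
          case (4 k)
          have "j < k" "\<sigma> k < \<sigma> i"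
            using 231(1,4) unfolding i(2) j(2) 4(2) \<pi>_skip[OF i(1)] \<pi>_skip[OF 4(1)] skip_less_iff
            by auto
          then show False using H avoids231_onD[of "{1..r}" \<sigma> i j k] ij i(1) j(1) 4(1) by blast
        qed
      qed
    qed
  qed
qed

lemma perm_class_insert3:
  assumes "\<sigma> permutes {1..r}"
  shows "(r + 3, insert3 r p \<sigma>) \<in> perm_class \<longleftrightarrow> ((r, \<sigma>), p) \<in> cut_class"
  unfolding perm_class_iff cut_class_iff avoids231_on_insert3[OF assms] short_cycles_insert3[OF assms]
  using assms insert3_permutes[OF assms] p by argo

lemma insert3_cases:
  assumes perm: "\<pi> permutes {1..r + 3}" and rim: "\<pi> 1 = r + 3" "\<pi> (p + 2) = 1" "\<pi> (r + 3) = p + 2"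
  obtains \<sigma> where "\<sigma> permutes {1..r}" "\<pi> = insert3 r p \<sigma>"
proof -
  have inj: "\<pi> u \<noteq> \<pi> v" if "u \<noteq> v" for u v
    using permutes_inj[OF perm] that by (simp add: inj_eq)
  have "\<pi> ` skip p ` {1..r} \<subseteq> skip p ` {1..r}"
  proof
    fix v assume "v \<in> \<pi> ` skip p ` {1..r}"
    then obtain u where u: "v = \<pi> u" "u \<in> {1..r + 3}" "u \<noteq> 1" "u \<noteq> p + 2" "u \<noteq> r + 3"
      unfolding skip_image[OF p] by blast
    have "v \<noteq> r + 3" "v \<noteq> 1" "v \<noteq> p + 2" unfolding u(1)
      using inj[OF u(3)] inj[OF u(4)] inj[OF u(5)] by (simp_all only: rim not_False_eq_True)
    moreover have "v \<in> {1..r + 3}" using permutes_in_image[OF perm] u by blast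
    ultimately show "v \<in> skip p ` {1..r}" unfolding skip_image[OF p] by blast
  qed
  then obtain \<sigma> \<tau> where \<sigma>: "\<sigma> permutes {1..r}" "\<pi> = glue \<sigma> \<tau>"
    using glue_cases[OF perm] by blast
  \<comment> \<open>The prescribed values of \<open>\<pi>\<close> at the three new points identify
    the second component as \<open>rot3\<close>.\<close>
  have "\<pi> = glue \<sigma> rot3"
  proof (rule glue_eqI)
    show "\<pi> (skip p i) = skip p (\<sigma> i)" if "i \<in> {1..r}" for i
      using glue_g[OF that] unfolding \<sigma>(2) .
    show "\<pi> (rim r p i) = rim r p (rot3 i)" if "i \<in> {1..3}" for i
    proof -
      from that consider "i = 1" | "i = 2" | "i = 3" by force
      then show ?thesis using rim by cases (simp_all only: rim_def rot3_def, simp_all)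
    qed
    show "\<pi> u = u" if "u \<notin> {1..r + 3}" for u
      using permutes_not_in[OF perm that] .
  qed
  then have "\<pi> = insert3 r p \<sigma>" unfolding insert3_def .
  with \<sigma>(1) show thesis by (rule that)
qed

end

lemma bij_betw_insert3:
  "bij_betw (\<lambda>((r, \<sigma>), p). (r + 3, insert3 r p \<sigma>)) cut_class cyc3_class"
  (is "bij_betw ?F _ _")
proof (rule bij_betw_imageI)
  show "inj_on ?F cut_class"
  proof (rule inj_onI)
    fix u v assume uv: "u \<in> cut_class" "v \<in> cut_class" "?F u = ?F v"
    obtain r \<sigma> p where u: "u = ((r, \<sigma>), p)" by (metis surj_pair)
    obtain r' \<sigma>' p' where v: "v = ((r', \<sigma>'), p')" by (metis surj_pair)
    have perm: "\<sigma> permutes {1..r}" "\<sigma>' permutes {1..r'}" and p: "p \<le> r" "p' \<le> r'"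
      using uv(1,2) unfolding u v by (auto simp: cut_class_iff perm_class_iff)
    have r: "r' = r" and eq: "insert3 r p \<sigma> = insert3 r' p' \<sigma>'"
      using uv(3) unfolding u v by auto
    \<comment> \<open>The height is read off from the last entry, which is
      \<open>p + 2\<close>.\<close>
    have "insert3 r p \<sigma> (r + 3) = insert3 r' p' \<sigma>' (r' + 3)" using eq r by simp
    then have p': "p' = p" using p by (simp only: insert3_rim)
    show "u = v"
      using insert3_inject[OF p(1) perm(1) perm(2)[unfolded r] eq[unfolded r p']]
      unfolding u v r p' by simp
  qed
  show "?F ` cut_class = cyc3_class"
  proof
    show "?F ` cut_class \<subseteq> cyc3_class"
    proof
      fix v assume "v \<in> ?F ` cut_class"
      then obtain r \<sigma> p where v: "v = (r + 3, insert3 r p \<sigma>)" and cut: "((r, \<sigma>), p) \<in> cut_class"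
        by auto
      then have p: "p \<le> r" and perm: "\<sigma> permutes {1..r}"
        by (auto simp: cut_class_iff perm_class_iff)
      show "v \<in> cyc3_class"
        using cut insert3_rim[OF p, of \<sigma>] perm_class_insert3[OF p perm] unfolding v
        by (simp add: cyc3_class_def top_class_iff)
    qed
    show "cyc3_class \<subseteq> ?F ` cut_class"
    proof
      fix v assume v_in: "v \<in> cyc3_class"
      obtain n \<pi> where v: "v = (n, \<pi>)" by (cases v)
      note \<pi> = cyc3_classD[OF v_in[unfolded v]]
      \<comment> \<open>No truncation occurs in either subtraction, since
        \<open>1 < \<pi> n < n\<close>.\<close>
      define r p where "r = n - 3" and "p = \<pi> n - 2"
      have n: "n = r + 3" and k: "\<pi> n = p + 2" and p: "p \<le> r"
        using \<pi>(5,6) by (auto simp: r_def p_def)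
      have "\<pi> permutes {1..r + 3}" "\<pi> 1 = r + 3" "\<pi> (p + 2) = 1" "\<pi> (r + 3) = p + 2"
        using \<pi>(1,3,4) k unfolding n by simp_all
      then obtain \<sigma> where \<sigma>: "\<sigma> permutes {1..r}" "\<pi> = insert3 r p \<sigma>"
        by (rule insert3_cases[OF p])
      have "(r + 3, insert3 r p \<sigma>) \<in> perm_class"
        using v_in unfolding v n \<sigma>(2) by (simp add: cyc3_class_def top_class_iff)
      then have "((r, \<sigma>), p) \<in> cut_class" using perm_class_insert3[OF p \<sigma>(1)] by simp
      moreover have "v = ?F ((r, \<sigma>), p)" unfolding v n \<sigma>(2) by simp
      ultimately show "v \<in> ?F ` cut_class" by (rule rev_image_eqI)
    qed
  qed
qed

section \<open>Assembling the functional equations\<close>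

text \<open>Each permutation of size \<open>r\<close> carries at most \<open>r + 1\<close>
  heights.\<close>

lemma finite_fibres_cut_class: "finite_fibres (\<lambda>u. perm_wt (fst u)) cut_class"
  unfolding finite_fibres_def
proof
  fix v
  let ?A = "{s \<in> perm_class. perm_wt s = v}"
  have "finite ?A" using finite_fibres_perm_class unfolding finite_fibres_def by blast
  then have "finite (SIGMA s:?A. {..fst s})" by (intro finite_SigmaI) auto
  moreover have "{u \<in> cut_class. perm_wt (fst u) = v} \<subseteq> (SIGMA s:?A. {..fst s})"
    by (auto simp: cut_class_def)
  ultimately show "finite {u \<in> cut_class. perm_wt (fst u) = v}" by (rule rev_finite_subset)
qed

lemma gf_cyc3_class: "gf perm_wt cyc3_class = gf (\<lambda>u. perm_wt (fst u)) cut_class * varY"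
proof -
  have "gf perm_wt cyc3_class = gf (\<lambda>u. perm_wt (fst u) + (0, 0, 1)) cut_class"
    by (rule gf_cong[OF bij_betw_insert3, symmetric])
      (auto simp: perm_wt_insert3 cut_class_iff perm_class_iff)
  also have "\<dots> = gf (\<lambda>u. perm_wt (fst u)) cut_class * varY"
    by (rule gf_shift_varY[OF finite_fibres_cut_class])
  finally show ?thesis .
qed

section \<open>Classification of the admissible pairs\<close>

text \<open>With \<open>k = \<sigma> r\<close> and \<open>\<sigma> k = 1\<close>, an ascent before
  position \<open>k\<close> would form a 231 pattern with the entry 1, and an ascent among entries
  above \<open>k\<close> would form one with the last entry. Position \<open>k\<close> and value
  \<open>k\<close> themselves cause no ascent, so both heights are allowed.\<close>

lemma cyc3_class_in_cut_class:
  assumes "(r, \<sigma>) \<in> cyc3_class" "p = \<sigma> r - 1 \<or> p = \<sigma> r"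
  shows "((r, \<sigma>), p) \<in> cut_class"
proof -
  note \<sigma> = cyc3_classD[OF assms(1)]
  define k where "k = \<sigma> r"
  have k: "\<sigma> k = 1" "1 < k" "k < r" "\<sigma> r = k" using \<sigma> by (auto simp: k_def)
  have p: "p \<le> k" "k \<le> p + 1" using assms(2) by (auto simp: k_def)
  have inj: "\<sigma> i \<noteq> \<sigma> j" if "i \<noteq> j" for i j
    using permutes_inj[OF \<sigma>(1)] that by (simp add: inj_eq)
  have mem: "1 \<le> \<sigma> i" if "1 \<le> i" "i \<le> r" for i
    using permutes_in_image[OF \<sigma>(1), of i] that by simp
  have left: "\<sigma> j < \<sigma> i" if ij: "1 \<le> i" "i < j" "j \<le> p" for i j
  proof (rule ccontr)
    assume "\<not> \<sigma> j < \<sigma> i"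
    then have less: "\<sigma> i < \<sigma> j" using inj[of i j] ij by auto
    have gt: "\<sigma> k < \<sigma> i" using mem[of i] inj[of i k] k ij p by auto
    then have "j \<noteq> k" using less by auto
    then show False using avoids231_onD[OF \<sigma>(2), of i j k] less gt ij p k by auto
  qed
  have high: "\<sigma> j < \<sigma> i" if ij: "1 \<le> i" "i < j" "j \<le> r" "p < \<sigma> i" "p < \<sigma> j" for i j
  proof (rule ccontr)
    assume "\<not> \<sigma> j < \<sigma> i"
    then have less: "\<sigma> i < \<sigma> j" using inj[of i j] ij by auto
    have gt: "\<sigma> r < \<sigma> i" using inj[of i r] k ij p by auto
    then have "j \<noteq> r" using less by auto
    then show False using avoids231_onD[OF \<sigma>(2), of i j r] less gt ij p k by auto
  qed
  have "(r, \<sigma>) \<in> perm_class" using assms(1) by (simp add: cyc3_class_def top_class_iff)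
  moreover have "p \<le> r" using p k by simp
  ultimately show ?thesis unfolding cut_class_iff using left high by blast
qed

text \<open>For \<open>p > k\<close> the first \<open>p\<close> entries would have to descend below
  the entry 1 at position \<open>k\<close>. For \<open>p < k - 1\<close> the values
  \<open>k - 1\<close> and \<open>k\<close> both exceed \<open>p\<close>, but \<open>k\<close> comes
  last and so ends an ascent.\<close>

lemma cyc3_class_cut_cases:
  assumes "((r, \<sigma>), p) \<in> cut_class" "(r, \<sigma>) \<in> cyc3_class"
  shows "p = \<sigma> r - 1 \<or> p = \<sigma> r"
proof -
  note \<sigma> = cyc3_classD[OF assms(2)]
  define k where "k = \<sigma> r"
  have k: "\<sigma> k = 1" "1 < k" "k < r" "\<sigma> r = k" using \<sigma> by (auto simp: k_def)
  have left: "\<sigma> j < \<sigma> i" if "1 \<le> i" "i < j" "j \<le> p" for i j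
    using assms(1) that unfolding cut_class_iff by blast
  have high: "\<sigma> j < \<sigma> i" if "1 \<le> i" "i < j" "j \<le> r" "p < \<sigma> i" "p < \<sigma> j" for i j
    using assms(1) that unfolding cut_class_iff by blast
  have "p \<le> k"
  proof (rule ccontr)
    assume "\<not> p \<le> k"
    then have "\<sigma> (k + 1) < \<sigma> k" using k by (intro left) auto
    moreover have "\<sigma> (k + 1) \<in> {1..r}" using permutes_in_image[OF \<sigma>(1), of "k + 1"] k by simp
    ultimately show False using k by simp
  qed
  moreover have "k - 1 \<le> p"
  proof (rule ccontr)
    assume p: "\<not> k - 1 \<le> p"
    have "k - 1 \<in> \<sigma> ` {1..r}" using permutes_image[OF \<sigma>(1)] k by auto
    then obtain u where u: "u \<in> {1..r}" "\<sigma> u = k - 1" by auto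
    then have "u \<noteq> r" using k by auto
    then have "\<sigma> r < \<sigma> u" using u p k by (intro high) auto
    then show False using u k by simp
  qed
  ultimately show ?thesis unfolding k_def by linarith
qed

lemma cut_class_dec: "p \<le> r \<Longrightarrow> ((r, dec r), p) \<in> cut_class"
  unfolding cut_class_iff using dec_in_perm_class by (auto simp: dec_def)

lemma cut_class_dsum: "((p + q, dsum p q (dec p) (dec q)), p) \<in> cut_class"
proof -
  let ?\<sigma> = "dsum p q (dec p) (dec q)"
  have left: "?\<sigma> i = p + 1 - i" if "1 \<le> i" "i \<le> p" for i
    using that by (simp add: dsum_left dec_def)
  have right: "?\<sigma> i = p + (q + 1 - (i - p))" if "p < i" "i \<le> p + q" for i
  proof -
    have "i - p \<in> {1..q}" "p + (i - p) = i" using that by auto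
    then show ?thesis
      using dsum_right[of "i - p" q p "dec p" "dec q"] by (simp only: dec_def if_True)
  qed
  have 1: "?\<sigma> j < ?\<sigma> i" if "1 \<le> i" "i < j" "j \<le> p" for i j
    using that left[of i] left[of j] by simp
  have 2: "?\<sigma> j < ?\<sigma> i" if "1 \<le> i" "i < j" "j \<le> p + q" "p < ?\<sigma> i" for i j
  proof -
    have "p < i" using left[of i] that by (cases "i \<le> p") auto
    then show ?thesis using that right[of i] right[of j] by simp
  qed
  show ?thesis
    unfolding cut_class_iff
    using 1 2 perm_class_dsum[OF dec_permutes dec_permutes] dec_in_perm_class by simp
qed

text \<open>For \<open>p = 0\<close> or \<open>p = r\<close> one of the two conditions covers all of
  \<open>\<sigma>\<close>. If \<open>\<sigma> 1 = r\<close>, then \<open>top_class_split\<close>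
  applies; otherwise the first \<open>p\<close> entries turn out to be exactly the values up to
  \<open>p\<close>.\<close>

lemma cut_class_cases:
  assumes cut: "((r, \<sigma>), p) \<in> cut_class"
  shows "\<sigma> = dec r \<or> (r, \<sigma>) \<in> cyc3_class \<or>
    (1 \<le> p \<and> p < r \<and> \<sigma> = dsum p (r - p) (dec p) (dec (r - p)))"
proof -
  have perm: "\<sigma> permutes {1..r}" and cls: "(r, \<sigma>) \<in> perm_class" and p: "p \<le> r"
    using cut by (auto simp: cut_class_iff perm_class_iff)
  have left: "\<sigma> j < \<sigma> i" if "1 \<le> i" "i < j" "j \<le> p" for i j
    using cut that unfolding cut_class_iff by blast
  have high: "\<sigma> j < \<sigma> i" if "1 \<le> i" "i < j" "j \<le> r" "p < \<sigma> i" "p < \<sigma> j" for i j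
    using cut that unfolding cut_class_iff by blast
  have mem: "\<sigma> i \<in> {1..r}" if "i \<in> {1..r}" for i
    using permutes_in_image[OF perm] that by blast
  have inj: "\<sigma> i \<noteq> \<sigma> j" if "i \<noteq> j" for i j
    using permutes_inj[OF perm] that by (simp add: inj_eq)
  consider "p = 0" | "p = r" | "1 \<le> p" "p < r" "\<sigma> 1 = r" | "1 \<le> p" "p < r" "\<sigma> 1 \<noteq> r"
    using p by linarith
  then show ?thesis
  proof cases
    case 1
    have "\<sigma> = dec r"
    proof (rule decreasing_imp_dec[OF perm])
      fix i j assume "1 \<le> i" "i < j" "j \<le> r"
      then show "\<sigma> j < \<sigma> i" using mem[of i] mem[of j] 1 by (intro high) auto
    qed
    then show ?thesis by simp
  next
    case 2
    then have "\<sigma> = dec r" using decreasing_imp_dec[OF perm] left by blast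
    then show ?thesis by simp
  next
    case 3
    then have "(r, \<sigma>) \<in> top_class" using cls by (simp add: top_class_iff)
    then show ?thesis unfolding top_class_split by auto
  next
    case 4
    have "r \<in> \<sigma> ` {1..r}" using permutes_image[OF perm] 4 by simp
    then obtain u where u: "u \<in> {1..r}" "\<sigma> u = r" by auto
    \<comment> \<open>The first \<open>p\<close> entries decrease from
      \<open>\<sigma> 1 < r\<close>, so the maximum comes later.\<close>
    have "p < u"
    proof (rule ccontr)
      assume "\<not> p < u"
      moreover have "u \<noteq> 1" using 4 u by auto
      ultimately have "\<sigma> u < \<sigma> 1" using u by (intro left) auto
      then show False using u mem[of 1] 4 by auto
    qed
    \<comment> \<open>A value above \<open>p\<close> at such a position would form an ascent with
      the maximum at position \<open>u\<close>.\<close>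
    have low: "\<sigma> v \<in> {1..p}" if v: "v \<in> {1..p}" for v
    proof (rule ccontr)
      have v_r: "v \<in> {1..r}" using v 4 by auto
      assume "\<sigma> v \<notin> {1..p}"
      then have "p < \<sigma> v" using mem[OF v_r] by auto
      then have "\<sigma> u < \<sigma> v" using v u \<open>p < u\<close> 4 by (intro high) auto
      then show False using u mem[OF v_r] by auto
    qed
    define q where "q = r - p"
    have r: "r = p + q" using 4 by (simp add: q_def)
    obtain \<alpha> \<beta> where ab: "\<alpha> permutes {1..p}" "\<beta> permutes {1..q}" "\<sigma> = dsum p q \<alpha> \<beta>"
      using dsum_cases[OF perm[unfolded r] low] by blast
    have "\<alpha> = dec p"
    proof (rule decreasing_imp_dec[OF ab(1)])
      fix i j assume "1 \<le> i" "i < j" "j \<le> p"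
      then show "\<alpha> j < \<alpha> i" using left[of i j] unfolding ab(3) by (simp add: dsum_left)
    qed
    moreover have "\<beta> = dec q"
    proof (rule decreasing_imp_dec[OF ab(2)])
      fix i j assume ij: "1 \<le> i" "i < j" "j \<le> q"
      have \<beta>: "\<sigma> (p + l) = p + \<beta> l" "1 \<le> \<beta> l" if "1 \<le> l" "l \<le> q" for l
        using dsum_right[of l q p \<alpha> \<beta>] permutes_in_image[OF ab(2), of l] that
        unfolding ab(3) by simp_all
      have "\<sigma> (p + j) < \<sigma> (p + i)"
        using ij r \<beta>[of i] \<beta>[of j] by (intro high) auto
      then show "\<beta> j < \<beta> i" using \<beta>[of i] \<beta>[of j] ij by auto
    qed
    ultimately show ?thesis using 4 ab(3) by (simp add: q_def)
  qed
qed

section \<open>Series of decreasing permutations and of all admissible pairs\<close>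

lemma dec_wt_add2: "dec_wt (n + 2) = dec_wt n + (0, 1, 0)"
  by (simp add: dec_wt_def)

lemma finite_fibres_dec_wt: "finite_fibres dec_wt S"
proof -
  have "n = a + 2 * b" if "dec_wt n = (a, b, c)" for n a b c
    using that by (auto simp: dec_wt_def)
  then have "{n \<in> S. dec_wt n = (a, b, c)} \<subseteq> {a + 2 * b}" for a b c by blast
  then show ?thesis
    unfolding finite_fibres_def by (metis finite.emptyI finite_insert finite_subset surj_pair)
qed

lemma gf_dec_wt: "gf dec_wt {1..} = gf dec_wt UNIV - 1"
proof -
  have "UNIV = {0} \<union> {1::nat..}" by auto
  then have "gf dec_wt UNIV = gf dec_wt {0} + gf dec_wt {1..}"
    using gf_Un[OF finite_fibres_dec_wt, of "{0}" "{1..}"] by simp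
  then show ?thesis using gf_singleton(1)[of dec_wt 0] by (simp add: dec_wt_def)
qed

text \<open>Sizes 0 and 1 contribute 1 and t; increasing the size by 2 adds one 2-cycle. Hence
  \<open>E = 1 + t + x E\<close>.\<close>

lemma gf_dec_wt_UNIV: "gf dec_wt UNIV * (1 - varX) = 1 + varT"
proof -
  have "(UNIV :: nat set) = {0} \<union> ({1} \<union> (\<lambda>n. n + 2) ` UNIV)"
    by (auto simp: image_iff) presburger
  then have "gf dec_wt UNIV = gf dec_wt ({0} \<union> ({1} \<union> (\<lambda>n. n + 2) ` UNIV))" by simp
  also have "\<dots> = gf dec_wt {0} + (gf dec_wt {1} + gf dec_wt ((\<lambda>n. n + 2) ` UNIV))"
    by (subst gf_Un[OF finite_fibres_dec_wt], force)+ simp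
  also have "gf dec_wt ((\<lambda>n. n + 2) ` UNIV) = gf (\<lambda>n. dec_wt n + (0, 1, 0)) UNIV"
    unfolding dec_wt_add2[symmetric] by (rule gf_image) (simp add: inj_on_def)
  also have "\<dots> = gf dec_wt UNIV * varX"
    by (rule gf_shift_varX[OF finite_fibres_dec_wt])
  also have "gf dec_wt {0} = 1" by (rule gf_singleton) (simp add: dec_wt_def)
  also have "gf dec_wt {1} = varT" by (rule gf_singleton) (simp add: dec_wt_def)
  finally show ?thesis by algebra
qed

text \<open>The pair \<open>(p, q)\<close> encodes the cut at height \<open>p\<close> of the
  decreasing permutation of size \<open>p + q\<close>. Separating \<open>q = 0\<close>,
  \<open>q = 1\<close> and \<open>q \<ge> 2\<close> gives
  \<open>M = E + (E - 1) + x M\<close>.\<close>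

lemma gf_dec_wt_pairs:
  "gf (\<lambda>(p, q). dec_wt (p + q)) UNIV * (1 - varX) = 2 * gf dec_wt UNIV - 1"
proof -
  let ?V = "\<lambda>(p, q). dec_wt (p + q)"
  have fin: "finite_fibres ?V S" for S
  proof (rule finite_fibres_subset)
    show "finite_fibres ?V UNIV"
      unfolding finite_fibres_def
    proof
      fix v
      have "finite {n. dec_wt n = v}"
        using finite_fibres_dec_wt[of UNIV, unfolded finite_fibres_def, THEN spec, of v] by simp
      then have "finite (\<Union>n\<in>{n. dec_wt n = v}. {..n} \<times> {..n})" by blast
      then show "finite {u \<in> UNIV. ?V u = v}" by (rule rev_finite_subset) force
    qed
  qed simp
  have "(UNIV :: (nat \<times> nat) set) =
      (\<lambda>p. (p, 0)) ` UNIV \<union> ((\<lambda>p. (p, 1)) ` UNIV \<union> (\<lambda>(p, q). (p, q + 2)) ` UNIV)"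
  proof -
    have "(p, q) \<in> (\<lambda>p. (p, 0)) ` UNIV \<union> ((\<lambda>p. (p, 1)) ` UNIV \<union> (\<lambda>(p, q). (p, q + 2)) ` UNIV)"
      for p q :: nat
    proof -
      consider "q = 0" | "q = 1" | q' where "q = q' + 2"
        by (metis One_nat_def add_2_eq_Suc' not0_implies_Suc)
      then show ?thesis by cases auto
    qed
    then show ?thesis by auto
  qed
  then have "gf ?V UNIV = gf ?V
      ((\<lambda>p. (p, 0)) ` UNIV \<union> ((\<lambda>p. (p, 1)) ` UNIV \<union> (\<lambda>(p, q). (p, q + 2)) ` UNIV))" by simp
  also have "\<dots> = gf ?V ((\<lambda>p. (p, 0)) ` UNIV) +
      (gf ?V ((\<lambda>p. (p, 1)) ` UNIV) + gf ?V ((\<lambda>(p, q). (p, q + 2)) ` UNIV))"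
    by (subst gf_Un[OF fin], force)+ simp
  also have "gf ?V ((\<lambda>p. (p, 0)) ` UNIV) = gf dec_wt UNIV"
    by (subst gf_image) (auto simp: inj_on_def)
  also have "gf ?V ((\<lambda>p. (p, 1)) ` UNIV) = gf dec_wt {1..}"
  proof -
    have "{1..} = (\<lambda>p. p + 1) ` (UNIV :: nat set)"
      by (auto simp: image_iff) presburger
    then have "gf dec_wt {1..} = gf (\<lambda>p. dec_wt (p + 1)) UNIV"
      by (simp only:) (rule gf_image, simp)
    then show ?thesis by (subst gf_image) (auto simp: inj_on_def)
  qed
  also have "gf ?V ((\<lambda>(p, q). (p, q + 2)) ` UNIV) = gf (\<lambda>u. ?V u + (0, 1, 0)) UNIV"
  proof (subst gf_image)
    have "?V (case u of (p, q) \<Rightarrow> (p, q + 2)) = ?V u + (0, 1, 0)" for u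
      using dec_wt_add2[of "fst u + snd u"] by (simp add: case_prod_beta add.assoc)
    then show "gf (\<lambda>u. ?V (case u of (p, q) \<Rightarrow> (p, q + 2))) UNIV = gf (\<lambda>u. ?V u + (0, 1, 0)) UNIV"
      by simp
  qed (auto simp: inj_on_def)
  also have "\<dots> = gf ?V UNIV * varX"
    by (rule gf_shift_varX[OF fin])
  also note gf_dec_wt
  finally show ?thesis by algebra
qed

lemma gf_top_class: "gf perm_wt top_class = gf dec_wt UNIV - 1 + gf perm_wt cyc3_class"
proof -
  have "gf perm_wt top_class = gf perm_wt ((\<lambda>n. (n, dec n)) ` {1..}) + gf perm_wt cyc3_class"
    unfolding top_class_split
    by (rule gf_Un) (use finite_fibres_top_class dec_not_in_cyc3_class in \<open>auto simp: top_class_split\<close>)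
  also have "gf perm_wt ((\<lambda>n. (n, dec n)) ` {1..}) = gf dec_wt {1..}"
    by (subst gf_image) (auto simp: inj_on_def perm_wt_dec)
  also note gf_dec_wt
  finally show ?thesis .
qed

lemma gf_cut_class:
  "gf (\<lambda>u. perm_wt (fst u)) cut_class =
    gf (\<lambda>(p, q). dec_wt (p + q)) UNIV + 2 * gf perm_wt cyc3_class + (gf dec_wt UNIV - 1)\<^sup>2"
proof -
  let ?W = "\<lambda>u :: (nat \<times> (nat \<Rightarrow> nat)) \<times> nat. perm_wt (fst u)"
  define f1 where "f1 = (\<lambda>(p, q). ((p + q, dec (p + q)), p))"
  define f2 where "f2 = (\<lambda>(r, \<sigma> :: nat \<Rightarrow> nat). ((r, \<sigma>), \<sigma> r - 1))"
  define f3 where "f3 = (\<lambda>(r, \<sigma> :: nat \<Rightarrow> nat). ((r, \<sigma>), \<sigma> r))"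
  define f4 where "f4 = (\<lambda>(p, q). ((p + q, dsum p q (dec p) (dec q)), p))"
  define A1 A2 A3 A4 where "A1 = f1 ` UNIV" and "A2 = f2 ` cyc3_class" and "A3 = f3 ` cyc3_class"
    and "A4 = f4 ` ({1..} \<times> {1..})"
  have split: "cut_class = A1 \<union> (A2 \<union> (A3 \<union> A4))"
  proof
    show "cut_class \<subseteq> A1 \<union> (A2 \<union> (A3 \<union> A4))"
    proof
      fix v assume v: "v \<in> cut_class"
      obtain r \<sigma> p where r: "v = ((r, \<sigma>), p)" by (metis surj_pair)
      have p: "p \<le> r" using v unfolding r cut_class_iff by simp
      consider "\<sigma> = dec r" | "(r, \<sigma>) \<in> cyc3_class"
        | "1 \<le> p" "p < r" "\<sigma> = dsum p (r - p) (dec p) (dec (r - p))"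
        using cut_class_cases[OF v[unfolded r]] by blast
      then show "v \<in> A1 \<union> (A2 \<union> (A3 \<union> A4))"
      proof cases
        case 1
        then have "v = f1 (p, r - p)" using p by (simp add: r f1_def)
        then show ?thesis by (simp add: A1_def)
      next
        case 2
        then have "v = f2 (r, \<sigma>) \<or> v = f3 (r, \<sigma>)"
          using cyc3_class_cut_cases[OF v[unfolded r]] by (auto simp: r f2_def f3_def)
        then show ?thesis using 2 unfolding A2_def A3_def by blast
      next
        case 3
        then have "v = f4 (p, r - p)" by (simp add: r f4_def)
        moreover have "(p, r - p) \<in> {1..} \<times> {1..}" using 3 by simp
        ultimately show ?thesis unfolding A4_def by blast
      qed
    qed
    show "A1 \<union> (A2 \<union> (A3 \<union> A4)) \<subseteq> cut_class"
      unfolding A1_def A2_def A3_def A4_def f1_def f2_def f3_def f4_def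
      using cut_class_dec cyc3_class_in_cut_class cut_class_dsum by auto
  qed
  \<comment> \<open>The first entry separates the direct sums from the other families: it is
    \<open>p < r\<close> there and \<open>r\<close> elsewhere. Size 0 is the exception, since the
    empty permutation maps 1 to itself, and is handled by \<open>pos_A4\<close>.\<close>
  have top_A4: "\<sigma> 1 \<noteq> r" if "((r, \<sigma>), p) \<in> A4" for r \<sigma> p
    using that by (auto simp: A4_def f4_def dsum_left dec_def)
  have top_A123: "\<sigma> 1 = r \<or> r = 0" if "((r, \<sigma>), p) \<in> A1 \<union> A2 \<union> A3" for r \<sigma> p
    using that by (auto simp: A1_def A2_def A3_def f1_def f2_def f3_def dec_def cyc3_class_def top_class_iff)
  have pos_A4: "r \<noteq> 0" if "((r, \<sigma>), p) \<in> A4" for r \<sigma> p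
    using that by (auto simp: A4_def f4_def)
  have "(A1 \<union> A2 \<union> A3) \<inter> A4 = {}"
    using top_A4 top_A123 pos_A4 by (metis disjoint_iff surj_pair)
  moreover have "A1 \<inter> (A2 \<union> A3) = {}"
    using dec_not_in_cyc3_class by (auto simp: A1_def A2_def A3_def f1_def f2_def f3_def)
  \<comment> \<open>The heights \<open>\<sigma> r - 1\<close> and \<open>\<sigma> r\<close> differ
    even with truncated subtraction, because \<open>\<sigma> r > 1\<close>.\<close>
  moreover have "A2 \<inter> A3 = {}"
    using cyc3_classD(5) by (fastforce simp: A2_def A3_def f2_def f3_def)
  ultimately have disj: "A1 \<inter> (A2 \<union> (A3 \<union> A4)) = {}" "A2 \<inter> (A3 \<union> A4) = {}" "A3 \<inter> A4 = {}"
    by blast+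
  have fin: "finite_fibres ?W S" if "S \<subseteq> cut_class" for S
    using finite_fibres_subset[OF finite_fibres_cut_class that] .
  have A23: "gf ?W A2 = gf perm_wt cyc3_class" "gf ?W A3 = gf perm_wt cyc3_class"
  proof -
    have "inj_on f2 cyc3_class" "inj_on f3 cyc3_class" by (auto simp: inj_on_def f2_def f3_def)
    moreover have "?W (f2 u) = perm_wt u" "?W (f3 u) = perm_wt u" for u
      by (simp_all add: f2_def f3_def case_prod_beta)
    ultimately show "gf ?W A2 = gf perm_wt cyc3_class" "gf ?W A3 = gf perm_wt cyc3_class"
      unfolding A2_def A3_def by (simp_all add: gf_image)
  qed
  have "gf ?W cut_class = gf ?W A1 + (gf ?W A2 + (gf ?W A3 + gf ?W A4))"
  proof -
    have "gf ?W cut_class = gf ?W A1 + gf ?W (A2 \<union> (A3 \<union> A4))"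
      unfolding split by (rule gf_Un[OF fin disj(1)]) (simp add: split)
    moreover have "gf ?W (A2 \<union> (A3 \<union> A4)) = gf ?W A2 + gf ?W (A3 \<union> A4)"
      by (rule gf_Un[OF fin disj(2)]) (simp add: split)
    moreover have "gf ?W (A3 \<union> A4) = gf ?W A3 + gf ?W A4"
      by (rule gf_Un[OF fin disj(3)]) (auto simp: split)
    ultimately show ?thesis by simp
  qed
  also have "gf ?W A1 = gf (\<lambda>(p, q). dec_wt (p + q)) UNIV"
  proof -
    have "inj f1" by (auto simp: inj_on_def f1_def)
    moreover have "?W (f1 u) = (\<lambda>(p, q). dec_wt (p + q)) u" for u
      by (simp add: f1_def case_prod_beta perm_wt_dec)
    ultimately show ?thesis unfolding A1_def by (simp add: gf_image)
  qed
  also have "gf ?W A2 = gf perm_wt cyc3_class" by (fact A23)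
  also have "gf ?W A3 = gf perm_wt cyc3_class" by (fact A23)
  also have "gf ?W A4 = gf (\<lambda>(p, q). dec_wt p + dec_wt q) ({1..} \<times> {1..})"
  proof -
    have "inj_on f4 ({1..} \<times> {1..})" by (auto simp: inj_on_def f4_def)
    moreover have "?W (f4 u) = (\<lambda>(p, q). dec_wt p + dec_wt q) u" for u
      by (simp add: f4_def case_prod_beta perm_wt_dsum[OF dec_permutes dec_permutes] perm_wt_dec)
    ultimately show ?thesis unfolding A4_def by (simp add: gf_image)
  qed
  also have "\<dots> = (gf dec_wt UNIV - 1)\<^sup>2"
    unfolding gf_times[OF finite_fibres_dec_wt finite_fibres_dec_wt] gf_dec_wt power2_eq_square ..
  finally show ?thesis by (simp add: algebra_simps)
qed

theorem theorem3p1: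
  shows "Bseries * (1 - 3*varX - 3*varY - varT + 2*varX^2 + 5*varX*varY + varT*varX
                    - 5*varX^2*varY - 4*varT*varX*varY - varT^2*varY)
         = (1 - varX)^2 * (1 - 2*varY)"
proof -
  define B where "B = Bseries"
  define D where "D = gf perm_wt cyc3_class"
  define E where "E = gf dec_wt UNIV"
  define M where "M = gf (\<lambda>(p, q). dec_wt (p + q)) UNIV"
  have B: "B = 1 + B * (E - 1 + D)"
    using gf_perm_class unfolding gf_top_class B_def D_def E_def Bseries_eq_gf .
  have D: "D = (M + 2 * D + (E - 1)\<^sup>2) * varY"
    using gf_cyc3_class unfolding gf_cut_class D_def E_def M_def .
  have E: "E * (1 - varX) = 1 + varT"
    unfolding E_def by (rule gf_dec_wt_UNIV)
  have M: "M * (1 - varX) = 2 * E - 1"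
    unfolding M_def E_def by (rule gf_dec_wt_pairs)
  \<comment> \<open>Multiplying \<open>B * (2 - E - D) = 1\<close> by
    \<open>(1 - x)^2 * (1 - 2 y)\<close> clears all denominators: the factor \<open>1 - 2 y\<close>
    eliminates \<open>D\<close>, and the powers of \<open>1 - x\<close> eliminate \<open>E\<close>
    and \<open>M\<close>. No division of series is needed.\<close>
  show ?thesis
    unfolding B_def[symmetric] using B D E M by algebra
qed

end
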